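(* Let $\varphi(x) \in \mathbb{Z}[x]$ be a given polynomial of degree $m \ge 2$. Suppose there exists a fixed integer $c$ such that $\varphi(c-x) = \varphi(x)$ (as polynomials in $x$). For every odd prime $p$ for which the reduction of $\varphi$ modulo $p$ (as a polynomial in $\mathbb F_p[x]$) is nonconstant, we have $$\left|f_\varphi(p)-\frac{(p-1)^2}{4p}\right|\leq \frac{2}{\pi^2}\left((m-1)\sqrt{p}+2|c|+3\right)\log(3p).$$ In particular, as $p$ ranges over all odd primes, $$f_\varphi(p) = \frac{p}{4} + O_\varphi(\sqrt{p}\log p).$$
   Context: For $\varphi\in\mathbb Z[x]$ and an odd prime $p$, $$f_\varphi(p) := \#\left\{k\in\mathbb Z : 1 \le k < \tfrac{p}{2},\ \left\{\tfrac{\varphi(k)}{p}\right\} > \tfrac{1}{2}\right\},$$ where $\{t\}$ denotes the fractional part of a real number $t$. Here $\log$ is the natural logarithm. $F = O_\varphi(G)$ means $|F|\le cG$ for a constant $c>0$ depending only on $\varphi$ (its degree and coefficients), not on $p$. *)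

theory Defs
  imports
    Complex_Main
    "HOL-Computational_Algebra.Polynomial"
    "HOL-Computational_Algebra.Primes"
begin

definition f_count :: "int poly \<Rightarrow> nat \<Rightarrow> nat" where
  "f_count \<phi> p =
     card {k :: int. 1 \<le> k \<and> real_of_int k < real p / 2 \<and>
                     frac (real_of_int (poly \<phi> k) / real p) > 1 / 2}"

(* An element of F_p[x] is represented by the integer polynomial whose coefficients are the
   representatives in {0..<p}. The representative of the residue class 0 is 0, so the degree
   of this polynomial is the degree of the reduction over F_p. *)
definition reduce_mod :: "nat \<Rightarrow> int poly \<Rightarrow> int poly" where
  "reduce_mod p \<phi> = map_poly (\<lambda>a. a mod int p) \<phi>"

end

theory Submission
  imports
    "HOL-Algebra.Algebraic_Closure_Type"
    "Berlekamp_Zassenhaus.Finite_Field"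
    "HOL-Analysis.Kronecker_Approximation_Theorem"
    Defs
begin

text \<open>
  Write \<open>p = 2 * P + 1\<close>, \<open>e(t) = exp (2 \<pi> i t / p)\<close>, and let \<open>S h\<close> be the sum of
  \<open>e (h * \<phi> k)\<close> over \<open>1 \<le> k \<le> P\<close>.  The number \<open>f_count \<phi> p\<close> counts the \<open>k\<close> in this half range for
  which the residue of \<open>\<phi> k\<close> lies in the upper half \<open>{P+1..2P}\<close>.  Detecting the residue by the
  orthogonality of additive characters turns the count into
  \<open>(1/p)\<close> times the sum over \<open>h\<close> of \<open>T h * S h\<close>, where \<open>T h\<close> is a geometric sum over the upper half.
  The term \<open>h = 0\<close> is the main term \<open>(p-1)^2 / (4p)\<close>.

  The reflection \<open>k \<mapsto> c - k\<close> carries the half range \<open>{1..P}\<close> to a translate, by \<open>c\<close>, of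
  \<open>{-P..-1}\<close>, which together with \<open>{1..P}\<close> and \<open>0\<close> is a complete system of residues.  Hence \<open>2 * S h\<close> differs
  from the complete exponential sum by at most \<open>2 * |c| + 1\<close> (\<open>symmetric_half_sum\<close>), and the problem of
  incomplete sums disappears.  For \<open>1 \<le> h < p\<close> the complete sum has modulus at most \<open>(m - 1) * sqrt p\<close> by Weil's theorem, and
  the sum of the \<open>|T h|\<close> is a cosecant sum that a comparison with the integral of the cosecant
  bounds by \<open>(4 p / \<pi>^2) * ln (3 p)\<close> (\<open>csc_sum_bound\<close>).

  Weil's bound for additive character sums is proved here from first principles, in an algebraic
  closure of the field with \<open>p\<close> elements.  It has two halves.

  (1) Let \<open>char_sum n\<close> be the sum, over the field with \<open>p^n\<close> elements, of the character applied to the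
  trace of the value of the polynomial.  The generating L-function of these sums is itself a sum of a multiplicative
  function over the Frobenius-stable multisets of points (equivalently, over the monic polynomials with coefficients
  in the prime field).  For polynomials of degree at least \<open>d = degree f\<close> one can move a single
  coefficient, which by Newton's identities changes the \<open>d\<close>-th power sum of the roots and no
  lower one; so the character runs over all its values and the sum cancels.  The L-function
  is therefore a polynomial of degree less than \<open>d\<close>, and \<open>char_sum n\<close> is, up to sign, a power sum of \<open>d - 1\<close>
  fixed complex numbers (\<open>char_sum_eq_power_sum\<close>).

  (2) Bombieri's form of Stepanov's method (\<open>bombieri_bound\<close>) gives
  \<open>|char_sum n| \<le> C * p^(n/2)\<close> for all large even \<open>n\<close>.  Any constant suffices: simultaneous Diophantine
  approximation aligns the arguments of the \<open>d - 1\<close> numbers, so each of them has modulus at most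
  \<open>sqrt p\<close> (\<open>power_sums_bounded_imp_le\<close>), and the case \<open>n = 1\<close> is Weil's bound (\<open>weil_bound\<close>).

  A type cannot depend on the prime \<open>p\<close>, whereas the argument wants a field of characteristic \<open>p\<close>
  as a type.  It is enough to construct this type for one well-chosen prime, a prime that violates Weil's bound if any prime
  does (\<open>critical_prime\<close>).
\<close>

section \<open>Newton's identities, power sums and linear systems\<close>

text \<open>
  Newton's identities as a relation between two sequences.  It is satisfied by the power
  sums and the signed elementary symmetric functions of a multiset, and also by the negated
  character sums and the coefficients of their L-function; the two are played against each other below.
\<close>

definition newton_pair :: "(nat \<Rightarrow> 'a :: comm_ring_1) \<Rightarrow> (nat \<Rightarrow> 'a) \<Rightarrow> bool" where
  "newton_pair s e \<longleftrightarrow> (\<forall>k\<ge>1. (\<Sum>i=1..k. s i * e (k - i)) = - (of_nat k * e k))"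

lemma newton_pair_step:
  assumes "newton_pair s e" "e 0 = 1" "d \<ge> 1"
  shows "s d = - (of_nat d * e d) - (\<Sum>i=1..<d. s i * e (d - i))"
proof -
  have "(\<Sum>i=1..d. s i * e (d - i)) = s d * e 0 + (\<Sum>i=1..<d. s i * e (d - i))"
    using assms(3) by (simp add: sum.last_plus)
  with assms show ?thesis
    unfolding newton_pair_def by (simp add: algebra_simps)
qed

lemma newton_pair_agree:
  assumes "newton_pair s e" "newton_pair s' e'" "e 0 = 1" "e' 0 = 1"
    and agree: "\<And>i. i < d \<Longrightarrow> e i = e' i"
  shows "1 \<le> k \<Longrightarrow> k < d \<Longrightarrow> s k = s' k"
proof (induction k rule: less_induct)
  case (less k)
  have "(\<Sum>i=1..<k. s i * e (k - i)) = (\<Sum>i=1..<k. s' i * e' (k - i))"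
    using less by (intro sum.cong refl) (auto simp: agree)
  then show ?case
    using newton_pair_step[OF assms(1,3) less.prems(1)] newton_pair_step[OF assms(2,4) less.prems(1)]
      agree[of k] less.prems by simp
qed

text \<open>
  The first index at which the elementary symmetric functions of two multisets differ is also the
  first at which their power sums differ, and the two differences are proportional.
\<close>

lemma newton_pair_first_difference:
  assumes "newton_pair s e" "newton_pair s' e'" "e 0 = 1" "e' 0 = 1"
    and agree: "\<And>i. i < d \<Longrightarrow> e i = e' i" and d: "d \<ge> 1"
  shows "s' d - s d = of_nat d * (e d - e' d)"
proof -
  have "(\<Sum>i=1..<d. s i * e (d - i)) = (\<Sum>i=1..<d. s' i * e' (d - i))"
    using newton_pair_agree[OF assms(1-4) agree] by (intro sum.cong refl) (auto simp: agree)
  then show ?thesis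
    unfolding newton_pair_step[OF assms(1,3) d] newton_pair_step[OF assms(2,4) d]
    by (simp add: algebra_simps)
qed

text \<open>
  The logarithmic derivative of the product of the factors \<open>1 - a X\<close> is, up to the factor \<open>- X\<close>, the
  generating function of the power sums, because it is additive in the multiset and geometric for one point.
\<close>

lemma newton_pair_power_sums:
  fixes A :: "'a :: idom multiset"
  shows "newton_pair (\<lambda>i. \<Sum>a\<in>#A. a ^ i) (coeff (\<Prod>a\<in>#A. [:1, -a:]))"
proof -
  define P where "P = (\<lambda>A. Abs_fps (\<lambda>n. if n = 0 then 0 else (\<Sum>a\<in>#A. (a::'a) ^ n)))"
  define E where "E = (\<lambda>A::'a multiset. fps_of_poly (\<Prod>a\<in>#A. [:1, -a:]))"
  have lin: "fps_of_poly [:1, -a:] = 1 - fps_const a * fps_X" for a :: 'a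
    by (simp add: fps_of_poly_pCons)
  have geo: "P {#a#} * (1 - fps_const a * fps_X) = fps_const a * fps_X" for a
  proof (rule fps_ext)
    fix n
    have "P {#a#} * (1 - fps_const a * fps_X) = P {#a#} - fps_const a * (fps_X * P {#a#})"
      by (simp add: algebra_simps)
    also have "fps_nth \<dots> n = fps_nth (P {#a#}) n - a * (if n = 0 then 0 else fps_nth (P {#a#}) (n - 1))"
      by simp
    also have "\<dots> = fps_nth (fps_const a * fps_X) n"
    proof (cases "n \<le> 1")
      case False
      then obtain m where "n = Suc (Suc m)" by (metis Suc_le_D not_less_eq_eq One_nat_def)
      then show ?thesis by (simp add: P_def)
    qed (auto simp: P_def le_Suc_eq)
    finally show "fps_nth (P {#a#} * (1 - fps_const a * fps_X)) n = fps_nth (fps_const a * fps_X) n" .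
  qed
  have main: "P A * E A = - (fps_X * fps_deriv (E A))"
  proof (induction A)
    case empty show ?case by (simp add: E_def P_def fps_eq_iff)
  next
    case (add a A)
    have P: "P (add_mset a A) = P A + P {#a#}"
      by (rule fps_ext) (simp add: P_def)
    have E: "E (add_mset a A) = (1 - fps_const a * fps_X) * E A"
      by (simp add: E_def fps_of_poly_mult lin)
    have "P (add_mset a A) * E (add_mset a A)
        = (1 - fps_const a * fps_X) * (P A * E A) + (P {#a#} * (1 - fps_const a * fps_X)) * E A"
      unfolding P E by (simp add: algebra_simps)
    also have "\<dots> = - (fps_X * fps_deriv (E (add_mset a A)))"
      unfolding add geo E by (simp add: algebra_simps)
    finally show ?case .
  qed
  show ?thesis unfolding newton_pair_def
  proof (intro allI impI)
    fix k :: nat assume k: "k \<ge> 1"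
    have "fps_nth (P A * E A) k = (\<Sum>i=0..k. fps_nth (P A) i * fps_nth (E A) (k - i))"
      by (simp add: fps_mult_nth)
    also have "\<dots> = (\<Sum>i=1..k. fps_nth (P A) i * fps_nth (E A) (k - i))"
      by (rule sum.mono_neutral_right) (auto simp: P_def not_le)
    also have "\<dots> = (\<Sum>i=1..k. (\<Sum>a\<in>#A. a ^ i) * coeff (\<Prod>a\<in>#A. [:1, -a:]) (k - i))"
      by (intro sum.cong refl) (auto simp: P_def E_def)
    finally have "(\<Sum>i=1..k. (\<Sum>a\<in>#A. a ^ i) * coeff (\<Prod>a\<in>#A. [:1, -a:]) (k - i))
       = fps_nth (- (fps_X * fps_deriv (E A))) k" unfolding main by simp
    also have "\<dots> = - (of_nat k * coeff (\<Prod>a\<in>#A. [:1, -a:]) k)"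
      using k by (cases k) (auto simp: E_def fps_deriv_def)
    finally show "(\<Sum>i=1..k. (\<Sum>a\<in>#A. a ^ i) * coeff (\<Prod>a\<in>#A. [:1, -a:]) (k - i)) =
      - (of_nat k * coeff (\<Prod>a\<in>#A. [:1, -a:]) k)" .
  qed
qed

lemma reflect_prod_linear:
  fixes A :: "'a :: idom multiset"
  shows "reflect_poly (\<Prod>a\<in>#A. [:-a, 1:]) = (\<Prod>a\<in>#A. [:1, -a:])"
proof (induction A)
  case (add a A)
  have "reflect_poly [:-a, 1:] = [:1, -a:]"
    by (simp add: reflect_poly_def)
  with add show ?case by (simp add: reflect_poly_mult del: mult_pCons_left)
qed auto

lemma degree_prod_linear:
  fixes A :: "'a :: idom multiset"
  shows "degree (\<Prod>a\<in>#A. [:-a, 1:]) = size A" "lead_coeff (\<Prod>a\<in>#A. [:-a, 1:]) = 1"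
proof -
  have *: "degree (\<Prod>a\<in>#A. [:-a, 1:]) = size A \<and> lead_coeff (\<Prod>a\<in>#A. [:-a, 1:]) = 1
    \<and> (\<Prod>a\<in>#A. [:-a, 1:]) \<noteq> 0"
  proof (induction A)
    case (add a A)
    then have "degree ([:-a, 1:] * (\<Prod>a\<in>#A. [:-a, 1:])) = Suc (size A)"
      by (subst degree_mult_eq) auto
    moreover have "lead_coeff ([:-a, 1:] * (\<Prod>a\<in>#A. [:-a, 1:])) = 1"
      by (subst lead_coeff_mult) (use add in auto)
    ultimately show ?case using add
      by (auto simp del: mult_pCons_left)
  qed auto
  then show "degree (\<Prod>a\<in>#A. [:-a, 1:]) = size A" "lead_coeff (\<Prod>a\<in>#A. [:-a, 1:]) = 1" by auto
qed

lemma coeff_prod_linear_reversed: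
  fixes A :: "'a :: idom multiset"
  assumes "i \<le> size A"
  shows "coeff (\<Prod>a\<in>#A. [:1, -a:]) i = coeff (\<Prod>a\<in>#A. [:-a, 1:]) (size A - i)"
  unfolding reflect_prod_linear[symmetric] coeff_reflect_poly degree_prod_linear using assms by auto

lemma proots_prod_linear:
  fixes A :: "'a :: idom multiset"
  shows "proots (\<Prod>a\<in>#A. [:-a, 1:]) = A"
proof (induction A)
  case (add a A)
  have "(\<Prod>a\<in>#A. [:-a, 1:]) \<noteq> 0"
    using degree_prod_linear(2)[of A] by fastforce
  with add show ?case by (simp add: proots_mult del: mult_pCons_left)
qed auto

lemma monic_eq_prod_proots:
  fixes g :: "'a :: alg_closed_field poly"
  assumes "lead_coeff g = 1"
  shows "g = (\<Prod>a\<in>#proots g. [:-a, 1:])" "size (proots g) = degree g"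
proof -
  have "g \<noteq> 0" using assms by auto
  then obtain A where A: "size A = degree g" "g = smult (lead_coeff g) (\<Prod>x\<in>#A. [:-x, 1:])"
    using alg_closed_imp_factorization by blast
  then have g: "g = (\<Prod>x\<in>#A. [:-x, 1:])" using assms by simp
  have "proots g = A" unfolding g by (rule proots_prod_linear)
  then show "g = (\<Prod>a\<in>#proots g. [:-a, 1:])" "size (proots g) = degree g" using g A by auto
qed

text \<open>
  Vanishing of \<open>c\<close> beyond \<open>n\<close> says that \<open>c\<close> lists the coefficients of a polynomial; the
  power sums of its reciprocal roots obey the recursion of \<open>- S\<close>.  The polynomial is reversed, so that it is
  monic of degree exactly \<open>n\<close>; zeros in \<open>W\<close> account for a drop of the degree of the original one.
\<close>

lemma newton_pair_finite_support:
  fixes S c :: "nat \<Rightarrow> complex"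
  assumes c0: "c 0 = 1" and van: "\<And>k. k > n \<Longrightarrow> c k = 0"
    and rec: "newton_pair (\<lambda>i. - S i) c"
  obtains W where "size W = n" "\<And>k. k \<ge> 1 \<Longrightarrow> S k = - (\<Sum>w\<in>#W. w ^ k)"
proof -
  define g where "g = Poly (map (\<lambda>i. c (n - i)) [0..<Suc n])"
  have cg: "coeff g i = (if i \<le> n then c (n - i) else 0)" for i
    by (auto simp: g_def nth_default_def simp del: upt_Suc)
  have dg: "degree g = n"
    by (rule antisym) (auto simp: cg c0 intro!: degree_le le_degree)
  define W where "W = proots g"
  have lg: "lead_coeff g = 1" by (simp add: dg cg c0)
  have gW: "g = (\<Prod>a\<in>#W. [:-a, 1:])" and sW: "size W = n"
    using monic_eq_prod_proots[OF lg] dg by (simp_all add: W_def)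
  have e: "coeff (\<Prod>a\<in>#W. [:1, -a:]) = c"
  proof
    fix i show "coeff (\<Prod>a\<in>#W. [:1, -a:]) i = c i"
    proof (cases "i \<le> n")
      case True
      then show ?thesis using coeff_prod_linear_reversed[of i W] by (simp add: sW cg flip: gW)
    next
      case False
      have "degree (\<Prod>a\<in>#W. [:1, -a:]) \<le> n"
        unfolding reflect_prod_linear[symmetric] using degree_reflect_poly_le[of g] dg gW by simp
      with False show ?thesis by (simp add: van coeff_eq_0)
    qed
  qed
  have np: "newton_pair (\<lambda>i. \<Sum>a\<in>#W. a ^ i) c"
    using newton_pair_power_sums[of W] unfolding e .
  have "S k = - (\<Sum>w\<in>#W. w ^ k)" if "k \<ge> 1" for k
    using newton_pair_agree[OF rec np c0 c0, of "Suc k" k] that by (metis lessI minus_minus)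
  with sW that show thesis by blast
qed

text \<open>
  No cancellation can hide a large \<open>w\<close> for all exponents: by Dirichlet's theorem there are arbitrarily large \<open>n\<close> for
  which all \<open>w ^ n\<close> point nearly in the positive real direction.
\<close>

lemma power_sums_bounded_imp_le:
  fixes W :: "complex multiset"
  assumes r: "r > 0" and bd: "\<And>n. n \<ge> n0 \<Longrightarrow> cmod (\<Sum>w\<in>#W. w ^ n) \<le> C * r ^ n"
    and w: "w \<in># W"
  shows "cmod w \<le> r"
proof (rule ccontr)
  assume "\<not> cmod w \<le> r"
  then have wr: "cmod w / r > 1" using r by simp
  then obtain n1 where n1: "(cmod w / r) ^ n1 > 2 * C"
    using real_arch_pow by blast
  define N where "N = max 1 (max n0 n1)"
  obtain ws where ws: "mset ws = W" using ex_mset by blast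
  define \<theta> where "\<theta> = (\<lambda>i. real N * (Arg (ws ! i) / (2 * pi)))"
  \<comment> \<open>The angles are multiplied by N beforehand, so that the exponent found is at least N; 1/8 of a turn leaves a cosine above 1/2.\<close>
  obtain q h where q: "0 < q" "q \<le> int (8 ^ length ws)" and h: "\<And>i. i < length ws \<Longrightarrow> \<bar>of_int q * \<theta> i - of_int (h i)\<bar> < 1 / real 8"
    by (rule Dirichlet_approx_simult[of 8 "length ws" \<theta>]) (simp, blast)
  define n where "n = nat q * N"
  have "1 * N \<le> nat q * N" using q by (intro mult_right_mono) linarith+
  then have n: "n \<ge> N" by (simp add: n_def)
  have re: "Re (z ^ n) \<ge> cmod z ^ n / 2" if "z \<in> set ws" for z
  proof -
    obtain i where i: "i < length ws" "z = ws ! i" using \<open>z \<in> set ws\<close> by (metis in_set_conv_nth)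
    have z: "z = cmod z * cis (Arg z)" by (simp add: rcis_cmod_Arg flip: rcis_def)
    have nn: "real n * Arg z = 2 * pi * (of_int q * \<theta> i)"
      using q by (simp add: n_def \<theta>_def i)
    define t where "t = of_int q * \<theta> i - of_int (h i)"
    have t: "\<bar>t\<bar> < 1 / 8" using h[OF i(1)] by (simp add: t_def)
    have "cos (real n * Arg z) = cos (2 * pi * t + 2 * pi * of_int (h i))"
      unfolding nn t_def by (simp add: algebra_simps)
    also have "\<dots> = cos (2 * pi * t)"
      by (simp add: cos_add)
    also have "\<dots> = cos \<bar>2 * pi * t\<bar>" by simp
    also have "\<dots> \<ge> cos (pi / 3)"
    proof (rule cos_monotone_0_pi_le)
      have "pi * (2 * \<bar>t\<bar>) \<le> pi * (1/3)" using t by (intro mult_left_mono) auto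
      then show "\<bar>2 * pi * t\<bar> \<le> pi / 3" by (simp add: abs_mult)
    qed auto
    finally have "cos (real n * Arg z) \<ge> 1 / 2" by (simp add: cos_60)
    moreover have "z ^ n = rcis (cmod z ^ n) (real n * Arg z)"
      by (metis DeMoivre2 rcis_cmod_Arg)
    ultimately show ?thesis
      using mult_left_mono[of "1/2" "cos (real n * Arg z)" "cmod z ^ n"] by (simp add: rcis_def)
  qed
  have "cmod w ^ n / 2 \<le> (\<Sum>z\<in>#W. cmod z ^ n / 2)"
  proof -
    obtain V where "W = add_mset w V" using w by (metis mset_add)
    moreover have "(\<Sum>z\<in>#V. cmod z ^ n / 2) \<ge> 0" by (induction V) auto
    ultimately show ?thesis by simp
  qed
  also have "\<dots> \<le> (\<Sum>z\<in>#W. Re (z ^ n))"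
    using re by (intro sum_mset_mono) (auto simp: ws[symmetric])
  also have "\<dots> = Re (\<Sum>z\<in>#W. z ^ n)"
    by (induction W) auto
  also have "\<dots> \<le> cmod (\<Sum>z\<in>#W. z ^ n)" by (rule complex_Re_le_cmod)
  also have "\<dots> \<le> C * r ^ n" using n by (intro bd) (simp add: N_def)
  finally have "(cmod w / r) ^ n \<le> 2 * C"
    using r by (simp add: field_simps power_divide)
  moreover have "(cmod w / r) ^ n1 \<le> (cmod w / r) ^ n"
    using n wr by (intro power_increasing) (auto simp: N_def)
  ultimately show False using n1 by linarith
qed

text \<open>
  Gaussian elimination: one equation serves to eliminate one unknown.
\<close>

lemma underdetermined_system_nontrivial_solution:
  fixes A :: "'i \<Rightarrow> 'e \<Rightarrow> 'a :: field"
  assumes "finite E" "finite I" "card E < card I"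
  shows "\<exists>c. (\<exists>i\<in>I. c i \<noteq> 0) \<and> (\<forall>e\<in>E. (\<Sum>i\<in>I. c i * A i e) = 0)"
  using assms
proof (induction E arbitrary: I A rule: finite_induct)
  case empty
  then obtain i where "i \<in> I" by fastforce
  then show ?case by (intro exI[of _ "\<lambda>_. 1"]) auto
next
  case (insert e E)
  show ?case
  proof (cases "\<forall>i\<in>I. A i e = 0")
    case True
    with insert.IH[of I A] insert.prems insert.hyps show ?thesis by auto
  next
    case False
    then obtain j where j: "j \<in> I" "A j e \<noteq> 0" by blast
    define J where "J = I - {j}"
    have J: "finite J" "I = insert j J" "j \<notin> J" using insert.prems j by (auto simp: J_def)
    have "card E < card J" using insert.prems insert.hyps J by simp
    then obtain c where c: "\<exists>i\<in>J. c i \<noteq> 0"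
      "\<forall>e'\<in>E. (\<Sum>i\<in>J. c i * (A i e' - A i e / A j e * A j e')) = 0"
      using insert.IH[of J "\<lambda>i e'. A i e' - A i e / A j e * A j e'"] J by auto
    \<comment> \<open>The value at j is forced by the equation e.\<close>
    define c' where "c' = c(j := - (\<Sum>i\<in>J. c i * A i e) / A j e)"
    have *: "(\<Sum>i\<in>I. c' i * A i e') = (\<Sum>i\<in>J. c i * (A i e' - A i e / A j e * A j e'))" for e'
    proof -
      have "(\<Sum>i\<in>I. c' i * A i e') = c' j * A j e' + (\<Sum>i\<in>J. c i * A i e')"
        using J by (auto simp: c'_def intro!: sum.cong)
      also have "c' j * A j e' = - (\<Sum>i\<in>J. c i * (A i e / A j e * A j e'))"
        by (simp add: c'_def sum_distrib_right sum_divide_distrib sum_distrib_left field_simps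
              flip: sum_negf)
      finally show ?thesis by (simp add: algebra_simps sum_subtractf)
    qed
    have "(\<Sum>i\<in>I. c' i * A i e) = 0" unfolding * using j by simp
    moreover have "\<exists>i\<in>I. c' i \<noteq> 0" using c(1) J by (auto simp: c'_def)
    ultimately show ?thesis using c(2) * by (intro exI[of _ c']) auto
  qed
qed

section \<open>Frobenius, finite subfields and the trace\<close>

text \<open>
  Inside an algebraically closed field of characteristic \<open>p\<close>, the fixed points of the \<open>n\<close>-th power of
  Frobenius form the subfield with \<open>p^n\<close> elements; \<open>GF 1\<close> is the prime field.
\<close>

definition GF :: "nat \<Rightarrow> 'k :: field_prime_char set" where
  "GF n = {x. x ^ (CHAR('k) ^ n) = x}"

text \<open>
  On \<open>GF n\<close> this is the trace to the prime field.
\<close>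

definition ftrace :: "nat \<Rightarrow> 'k \<Rightarrow> 'k :: field_prime_char" where
  "ftrace n x = (\<Sum>i<n. x ^ (CHAR('k) ^ i))"

lemma frobenius_add: "(x + y :: 'k :: field_prime_char) ^ (CHAR('k) ^ n) = x ^ (CHAR('k) ^ n) + y ^ (CHAR('k) ^ n)"
  by (rule freshmans_dream') auto

lemma frobenius_uminus: "(- x :: 'k :: field_prime_char) ^ (CHAR('k) ^ n) = - (x ^ (CHAR('k) ^ n))"
proof -
  have "0 = (x + - x) ^ (CHAR('k) ^ n)" by simp
  then show ?thesis unfolding frobenius_add by (metis add_eq_0_iff)
qed

lemma frobenius_diff: "(x - y :: 'k :: field_prime_char) ^ (CHAR('k) ^ n) = x ^ (CHAR('k) ^ n) - y ^ (CHAR('k) ^ n)"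
  using frobenius_add[of x "- y" n] by (simp add: frobenius_uminus)

lemma frobenius_sum: "(\<Sum>i\<in>A. h i :: 'k :: field_prime_char) ^ (CHAR('k) ^ n) = (\<Sum>i\<in>A. h i ^ (CHAR('k) ^ n))"
  by (rule freshmans_dream_sum') auto

lemma frobenius_inj: "(x :: 'k :: field_prime_char) ^ (CHAR('k) ^ n) = y ^ (CHAR('k) ^ n) \<longleftrightarrow> x = y"
proof
  assume "x ^ (CHAR('k) ^ n) = y ^ (CHAR('k) ^ n)"
  then have "(x - y) ^ (CHAR('k) ^ n) = 0" by (simp add: frobenius_diff)
  then show "x = y" by simp
qed simp

lemma GF_0: "0 \<in> GF n" and GF_1: "1 \<in> GF n"
  by (auto simp: GF_def zero_power)

lemma GF_add: "x \<in> GF n \<Longrightarrow> y \<in> GF n \<Longrightarrow> x + y \<in> GF n"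
  by (auto simp: GF_def frobenius_add)

lemma GF_diff: "x \<in> GF n \<Longrightarrow> y \<in> GF n \<Longrightarrow> x - y \<in> GF n"
  by (auto simp: GF_def frobenius_diff)

lemma GF_uminus: "x \<in> GF n \<Longrightarrow> - x \<in> GF n"
  by (auto simp: GF_def frobenius_uminus)

lemma GF_mult: "x \<in> GF n \<Longrightarrow> y \<in> GF n \<Longrightarrow> x * y \<in> GF n"
  by (auto simp: GF_def power_mult_distrib)

lemma GF_divide: "x \<in> GF n \<Longrightarrow> y \<in> GF n \<Longrightarrow> x / y \<in> GF n"
  by (auto simp: GF_def power_divide)

lemma GF_power: "x \<in> GF n \<Longrightarrow> x ^ k \<in> GF n"
  by (induction k) (auto simp: GF_1 GF_mult)

lemma GF_of_nat: "of_nat k \<in> GF n"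
  by (induction k) (auto simp: GF_0 GF_1 GF_add)

lemma frobenius_frobenius: "((x :: 'k :: field_prime_char) ^ (CHAR('k) ^ m)) ^ (CHAR('k) ^ n) = x ^ (CHAR('k) ^ (m + n))"
  by (simp add: power_add flip: power_mult)

lemma GF_mono_dvd: 
  assumes "m dvd n" "(x :: 'k :: field_prime_char) \<in> GF m"
  shows "x \<in> GF n"
proof -
  have "x ^ (CHAR('k) ^ (m * l)) = x" for l
  proof (induction l)
    case (Suc l)
    have "x ^ (CHAR('k) ^ (m * Suc l)) = (x ^ (CHAR('k) ^ (m * l))) ^ (CHAR('k) ^ m)"
      by (simp only: frobenius_frobenius) (simp add: algebra_simps)
    with Suc assms(2) show ?case by (simp add: GF_def)
  qed auto
  with assms(1) show ?thesis by (auto simp: GF_def elim!: dvdE)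
qed

lemma GF_prime_subset: "GF 1 \<subseteq> GF n"
  using GF_mono_dvd[of 1 n] by auto

lemma poly_frobenius:
  fixes f :: "'k :: field_prime_char poly"
  assumes "\<And>i. coeff f i \<in> GF 1"
  shows "poly f x ^ (CHAR('k) ^ n) = poly f (x ^ (CHAR('k) ^ n))"
proof -
  have c: "coeff f i ^ (CHAR('k) ^ n) = coeff f i" for i
    using assms[of i] GF_prime_subset[of n] by (auto simp: GF_def)
  show ?thesis
    unfolding poly_altdef frobenius_sum by (simp add: power_mult_distrib c mult.commute flip: power_mult)
qed

lemma poly_in_GF:
  fixes f :: "'k :: field_prime_char poly"
  assumes "\<And>i. coeff f i \<in> GF 1" "x \<in> GF n"
  shows "poly f x \<in> GF n"
  using assms(2) by (simp add: GF_def poly_frobenius[OF assms(1)])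

lemma ftrace_diff: "ftrace n (x - y) = ftrace n x - ftrace n y"
  by (simp add: ftrace_def frobenius_diff sum_subtractf)

text \<open>
  The trace telescopes on \<open>y^p - y\<close>.  In particular, for a point \<open>(x, y)\<close> of the curve \<open>y^p - y = g x\<close>, trace zero
  of \<open>g x\<close> forces \<open>y\<close> into the finite field.
\<close>

lemma ftrace_artin_schreier:
  fixes y :: "'k :: field_prime_char"
  shows "ftrace n (y ^ CHAR('k) - y) = y ^ (CHAR('k) ^ n) - y"
proof -
  have "ftrace n (y ^ CHAR('k) - y) = (\<Sum>i<n. y ^ (CHAR('k) ^ Suc i) - y ^ (CHAR('k) ^ i))"
    unfolding ftrace_def frobenius_diff by (simp flip: power_mult)
  then show ?thesis using sum_lessThan_telescope[of "\<lambda>i. y ^ (CHAR('k) ^ i)" n] by simp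
qed

lemma ftrace_in_prime_field:
  assumes "(x :: 'k :: field_prime_char) \<in> GF n"
  shows "ftrace n x \<in> GF 1"
proof -
  have "ftrace n x ^ CHAR('k) - ftrace n x = ftrace n (x ^ CHAR('k) - x)"
    using frobenius_sum[of "\<lambda>i. x ^ (CHAR('k) ^ i)" "{..<n}" 1]
    by (simp add: ftrace_def frobenius_diff sum_subtractf mult.commute flip: power_mult)
  also have "\<dots> = 0" using assms by (simp add: ftrace_artin_schreier GF_def)
  finally show ?thesis by (simp add: GF_def)
qed

text \<open>
  The polynomial \<open>X^q - X\<close> splits, and its roots are simple because its derivative is \<open>-1\<close>.
\<close>

lemma card_GF:
  assumes "n \<ge> 1"
  shows "card (GF n :: 'k :: {alg_closed_field, field_prime_char} set) = CHAR('k) ^ n"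
    and "finite (GF n :: 'k set)"
proof -
  define q where "q = CHAR('k) ^ n"
  have "CHAR('k) \<ge> 2" using prime_ge_2_nat[OF CHAR_prime] .
  then have q: "q \<ge> 2" using assms self_le_power[of "CHAR('k)" n] by (simp add: q_def)
  define h where "h = monom 1 q - monom (1::'k) 1"
  have deg: "degree h = q"
    using q degree_add_eq_left[of "- monom (1::'k) 1" "monom 1 q"] by (simp add: h_def degree_monom_eq)
  then have h0: "h \<noteq> 0" using q by auto
  have q0: "(of_nat q :: 'k) = 0" using assms by (simp add: q_def)
  have deriv: "pderiv h = -1"
    using q0 by (simp add: h_def pderiv_diff pderiv_monom monom_0 one_pCons)
  have ord: "order x h \<le> 1" for x
  proof (rule ccontr)
    assume "\<not> order x h \<le> 1"
    then have "[:-x, 1:] ^ 2 dvd h" using h0 by (simp add: order_divides)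
    then obtain k where "h = [:-x, 1:] * ([:-x, 1:] * k)" by (metis dvdE power2_eq_square mult.assoc)
    then have "poly (pderiv h) x = 0" by (simp add: pderiv_mult del: mult_pCons_left)
    then show False unfolding deriv by simp
  qed
  have cnt: "count (proots h) x = (if x \<in> GF n then 1 else 0)" for x
    using h0 ord[of x] order_root[of h x]
    by (auto simp: h_def poly_monom GF_def q_def le_Suc_eq)
  have set: "set_mset (proots h) = GF n" using h0
    by (auto simp: h_def poly_monom GF_def q_def)
  then show fin: "finite (GF n :: 'k set)" by (metis finite_set_mset)
  have "lead_coeff h = 1" using deg q by (simp add: h_def)
  then have "size (proots h) = q" using monic_eq_prod_proots(2)[of h] deg by simp
  moreover have "size (proots h) = (\<Sum>x\<in>(GF n :: 'k set). 1)"
    unfolding size_multiset_overloaded_eq set by (intro sum.cong refl) (simp add: cnt)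
  ultimately show "card (GF n :: 'k set) = CHAR('k) ^ n" by (simp add: q_def)
qed

lemma prime_field_eq_of_nat:
  "(GF 1 :: 'k :: {alg_closed_field, field_prime_char} set) = of_nat ` {..<CHAR('k)}"
proof (rule sym, rule card_subset_eq)
  show "finite (GF 1 :: 'k set)" by (rule card_GF) simp
  show "of_nat ` {..<CHAR('k)} \<subseteq> (GF 1 :: 'k set)" by (auto intro: GF_of_nat)
  have "inj_on (of_nat :: nat \<Rightarrow> 'k) {..<CHAR('k)}"
    by (auto simp: inj_on_def of_nat_eq_iff_cong_CHAR Cong.cong_def)
  then show "card (of_nat ` {..<CHAR('k)} :: 'k set) = card (GF 1 :: 'k set)"
    by (simp add: card_image card_GF)
qed

section \<open>Functions on an Artin-Schreier curve and Bombieri's point count\<close>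

text \<open>
  The affine curve \<open>y^p - y = g x\<close>, where \<open>d = degree g\<close> is prime to \<open>p\<close>.  It has one point at infinity, at
  which \<open>x\<close> has a pole of order \<open>p\<close> and \<open>y\<close> a pole of order \<open>d\<close>.  The coordinate ring is never
  formed: functions of two variables are compared only at the points of the curve, and the pole
  order is read off from exponents.
\<close>

locale artin_schreier =
  fixes g :: "'k :: {alg_closed_field, field_prime_char} poly"
  assumes degree_pos: "degree g \<ge> 1" and coprime_degree: "coprime (degree g) CHAR('k)"
begin

abbreviation d where "d \<equiv> degree g"

definition on_curve :: "'k \<Rightarrow> 'k \<Rightarrow> bool" where
  "on_curve x y \<longleftrightarrow> y ^ CHAR('k) - y = poly g x"

definition pole_order :: "nat \<times> nat \<Rightarrow> nat" where
  "pole_order e = fst e * CHAR('k) + snd e * d"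

definition monomial :: "nat \<times> nat \<Rightarrow> 'k \<Rightarrow> 'k \<Rightarrow> 'k" where
  "monomial e x y = x ^ fst e * y ^ snd e"

text \<open>
  Monomials with \<open>y\<close>-degree below \<open>p\<close> are a basis of the coordinate ring, and they have distinct pole orders.
\<close>

definition reduced_exps :: "nat \<Rightarrow> (nat \<times> nat) set" where
  "reduced_exps W = {e. snd e < CHAR('k) \<and> pole_order e < W}"

text \<open>
  The Riemann-Roch space of functions whose pole order at infinity is less than \<open>W\<close>.
\<close>

definition pole_space :: "nat \<Rightarrow> ('k \<Rightarrow> 'k \<Rightarrow> 'k) set" where
  "pole_space W = {h. \<exists>a. \<forall>x y. on_curve x y \<longrightarrow> h x y = (\<Sum>e\<in>reduced_exps W. a e * monomial e x y)}"

lemma p_ge_2: "CHAR('k) \<ge> 2"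
  using prime_ge_2_nat[OF CHAR_prime] .

text \<open>
  This is where coprimality of \<open>d\<close> and \<open>p\<close> enters: the pole order determines the exponent of \<open>y\<close> modulo \<open>p\<close>.
\<close>

lemma inj_on_pole_order: "inj_on pole_order {e. snd e < CHAR('k)}"
proof (rule inj_onI, clarsimp simp: pole_order_def)
  fix i j i' j' assume j: "j < CHAR('k)" "j' < CHAR('k)" and eq: "i * CHAR('k) + j * d = i' * CHAR('k) + j' * d"
  have "[j * d = j' * d] (mod CHAR('k))"
    using arg_cong[OF eq, of "\<lambda>k. k mod CHAR('k)"] by (simp add: Cong.cong_def)
  then have "[j = j'] (mod CHAR('k))"
    using coprime_degree by (simp add: cong_mult_rcancel_nat)
  then have "j = j'" using j by (simp add: Cong.cong_def)
  then show "i = i' \<and> j = j'" using eq p_ge_2 by simp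
qed

lemma finite_reduced_exps: "finite (reduced_exps W)" and card_reduced_exps_le: "card (reduced_exps W) \<le> W"
proof -
  have inj: "inj_on pole_order (reduced_exps W)" using inj_on_pole_order by (rule inj_on_subset) (auto simp: reduced_exps_def)
  have sub: "pole_order ` reduced_exps W \<subseteq> {..<W}" by (auto simp: reduced_exps_def)
  show "finite (reduced_exps W)" using inj_on_finite[OF inj sub] by simp
  show "card (reduced_exps W) \<le> W" using card_inj_on_le[OF inj sub] by simp
qed

text \<open>
  A crude form of Riemann's inequality: every \<open>v \<ge> (p - 1) * d\<close> is the pole order of a reduced monomial, since
  some \<open>j < p\<close> satisfies \<open>j * d \<equiv> v\<close> modulo \<open>p\<close>, and then \<open>v - j * d\<close> is a nonnegative multiple of \<open>p\<close>.
\<close>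

lemma card_reduced_exps_ge: "W \<le> card (reduced_exps W) + (CHAR('k) - 1) * d"
proof -
  have "{(CHAR('k) - 1) * d..<W} \<subseteq> pole_order ` reduced_exps W"
  proof
    fix v assume v: "v \<in> {(CHAR('k) - 1) * d..<W}"
    obtain j0 where j0: "[d * j0 = 1] (mod CHAR('k))"
      using cong_solve_coprime_nat[OF coprime_degree] by auto
    define j where "j = (v * j0) mod CHAR('k)"
    have jp: "j < CHAR('k)" using p_ge_2 by (simp add: j_def)
    have "[j * d = v * j0 * d] (mod CHAR('k))" unfolding j_def by (intro cong_mult cong_mod_left) auto
    also have "[v * j0 * d = v * 1] (mod CHAR('k))"
      using cong_mult[OF cong_refl[of v] j0] by (simp add: mult_ac)
    finally have "[v = j * d] (mod CHAR('k))" by (simp add: cong_sym_eq)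
    moreover have le: "j * d \<le> v"
    proof -
      have "j * d \<le> (CHAR('k) - 1) * d" using jp by (intro mult_right_mono) auto
      then show ?thesis using v by (meson atLeastLessThan_iff order_trans)
    qed
    ultimately obtain i where "v - j * d = i * CHAR('k)"
      by (metis cong_altdef_nat dvdE mult.commute)
    then have "v = pole_order (i, j)" using le by (simp add: pole_order_def)
    then show "v \<in> pole_order ` reduced_exps W" using v jp by (force simp: reduced_exps_def)
  qed
  then have "card {(CHAR('k) - 1) * d..<W} \<le> card (pole_order ` reduced_exps W)"
    by (intro card_mono finite_imageI finite_reduced_exps)
  also have "\<dots> \<le> card (reduced_exps W)" by (intro card_image_le finite_reduced_exps)
  finally show ?thesis by simp
qed

lemma pole_space_cong: "h \<in> pole_space W \<Longrightarrow> (\<And>x y. on_curve x y \<Longrightarrow> h' x y = h x y) \<Longrightarrow> h' \<in> pole_space W"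
  by (fastforce simp: pole_space_def)

lemma pole_space_0: "(\<lambda>x y. 0) \<in> pole_space W"
  by (auto simp: pole_space_def intro!: exI[of _ "\<lambda>_. 0"])

lemma pole_space_add:
  assumes "h \<in> pole_space W" "h' \<in> pole_space W" shows "(\<lambda>x y. h x y + h' x y) \<in> pole_space W"
proof -
  obtain a a' where "\<And>x y. on_curve x y \<Longrightarrow> h x y = (\<Sum>e\<in>reduced_exps W. a e * monomial e x y)"
    "\<And>x y. on_curve x y \<Longrightarrow> h' x y = (\<Sum>e\<in>reduced_exps W. a' e * monomial e x y)"
    using assms by (auto simp: pole_space_def)
  then have "\<forall>x y. on_curve x y \<longrightarrow> h x y + h' x y = (\<Sum>e\<in>reduced_exps W. (a e + a' e) * monomial e x y)"
    by (simp add: algebra_simps sum.distrib)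
  then show ?thesis unfolding pole_space_def mem_Collect_eq by (rule exI[of _ "\<lambda>e. a e + a' e"])
qed

lemma pole_space_scale:
  assumes "h \<in> pole_space W" shows "(\<lambda>x y. c * h x y) \<in> pole_space W"
proof -
  obtain a where "\<And>x y. on_curve x y \<Longrightarrow> h x y = (\<Sum>e\<in>reduced_exps W. a e * monomial e x y)"
    using assms by (auto simp: pole_space_def)
  then have "\<forall>x y. on_curve x y \<longrightarrow> c * h x y = (\<Sum>e\<in>reduced_exps W. (c * a e) * monomial e x y)"
    by (simp add: sum_distrib_left mult.assoc)
  then show ?thesis unfolding pole_space_def mem_Collect_eq by (rule exI[of _ "\<lambda>e. c * a e"])
qed

lemma pole_space_sum: "(\<And>i. i \<in> A \<Longrightarrow> h i \<in> pole_space W) \<Longrightarrow> (\<lambda>x y. \<Sum>i\<in>A. h i x y) \<in> pole_space W"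
  by (induction A rule: infinite_finite_induct) (auto intro: pole_space_0 pole_space_add)

lemma pole_space_mono: 
  assumes "W \<le> W'" shows "pole_space W \<subseteq> pole_space W'"
proof
  fix h assume "h \<in> pole_space W"
  then obtain a where a: "\<And>x y. on_curve x y \<Longrightarrow> h x y = (\<Sum>e\<in>reduced_exps W. a e * monomial e x y)"
    by (auto simp: pole_space_def)
  have "(\<Sum>e\<in>reduced_exps W. a e * monomial e x y) = (\<Sum>e\<in>reduced_exps W'. (if e \<in> reduced_exps W then a e else 0) * monomial e x y)" for x y
    using assms by (intro sum.mono_neutral_cong_left finite_reduced_exps) (auto simp: reduced_exps_def)
  with a show "h \<in> pole_space W'" by (auto simp: pole_space_def)
qed

lemma reduced_monomial_in_pole_space: "snd e < CHAR('k) \<Longrightarrow> pole_order e < W \<Longrightarrow> monomial e \<in> pole_space W"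
proof -
  assume "snd e < CHAR('k)" "pole_order e < W"
  then have "e \<in> reduced_exps W" by (simp add: reduced_exps_def)
  then have "monomial e x y = (\<Sum>e'\<in>reduced_exps W. (if e' = e then 1 else 0) * monomial e' x y)" for x y
    using finite_reduced_exps[of W] by (simp add: if_distrib[of "\<lambda>c. c * _"] cong: if_cong)
  then show ?thesis by (auto simp: pole_space_def intro!: exI[of _ "\<lambda>e'. if e' = e then 1 else 0"])
qed

text \<open>
  Replacing \<open>y^p\<close> by \<open>y + g x\<close> keeps the pole order, because the leading term of \<open>g\<close> contributes
  \<open>x^d\<close>, of the same order \<open>p * d\<close> as \<open>y^p\<close>, and everything else has smaller order.
\<close>

lemma monomial_leading_term:
  "\<exists>u e'. u \<noteq> 0 \<and> snd e' < CHAR('k) \<and> pole_order e' = pole_order e \<and> (\<lambda>x y. monomial e x y - u * monomial e' x y) \<in> pole_space (pole_order e)"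
proof (induction "snd e" arbitrary: e rule: less_induct)
  case less
  show ?case
  proof (cases "snd e < CHAR('k)")
    case True
    then show ?thesis by (intro exI[of _ 1] exI[of _ e]) (simp add: pole_space_0)
  next
    case False
    define i j where "i = fst e" and "j = snd e - CHAR('k)"
    have e: "e = (i, j + CHAR('k))" using False by (simp add: i_def j_def prod_eq_iff)
    have small: "monomial e' \<in> pole_space W" if lt: "snd e' < snd e" and W: "pole_order e' < W" for e' W
    proof -
      obtain u e'' where "u \<noteq> 0 \<and> snd e'' < CHAR('k) \<and> pole_order e'' = pole_order e' \<and>
          (\<lambda>x y. monomial e' x y - u * monomial e'' x y) \<in> pole_space (pole_order e')"
        using less[OF lt] by (elim exE)
      then have u: "snd e'' < CHAR('k)" "pole_order e'' = pole_order e'" "(\<lambda>x y. monomial e' x y - u * monomial e'' x y) \<in> pole_space (pole_order e')"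
        by simp_all
      have "(\<lambda>x y. monomial e' x y - u * monomial e'' x y) \<in> pole_space W"
        using u(3) pole_space_mono[of "pole_order e'" W] W by auto
      moreover have "monomial e'' \<in> pole_space W" using u W by (intro reduced_monomial_in_pole_space) auto
      ultimately show ?thesis
        by (rule pole_space_cong[OF pole_space_add[OF _ pole_space_scale]]) auto
    qed
    have p0: "CHAR('k) > 0" using p_ge_2 by simp
    obtain u e' where u: "u \<noteq> 0" "snd e' < CHAR('k)" "pole_order e' = pole_order (i + d, j)"
       "(\<lambda>x y. monomial (i + d, j) x y - u * monomial e' x y) \<in> pole_space (pole_order (i + d, j))"
      using less[of "(i + d, j)"] e p0 by auto
    have order_top: "pole_order (i + d, j) = pole_order e" by (simp add: pole_order_def e algebra_simps)
    \<comment> \<open>One reduction step on the curve; only the last summand keeps the pole order of e.\<close>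
    have expand: "monomial e x y = monomial (i, j + 1) x y + (\<Sum>k<d. coeff g k * monomial (i + k, j) x y)
        + lead_coeff g * monomial (i + d, j) x y" if "on_curve x y" for x y
    proof -
      have "y ^ CHAR('k) = y + (\<Sum>k\<le>d. coeff g k * x ^ k)"
        using that by (simp add: on_curve_def poly_altdef algebra_simps)
      then have "monomial e x y = x ^ i * y ^ j * (y + (\<Sum>k\<le>d. coeff g k * x ^ k))"
        by (simp add: monomial_def e power_add)
      also have "\<dots> = monomial (i, j + 1) x y + (\<Sum>k\<le>d. coeff g k * monomial (i + k, j) x y)"
        by (simp add: monomial_def algebra_simps sum_distrib_left power_add)
      also have "{..d} = insert d {..<d}" by auto
      finally show ?thesis by simp
    qed
    have "d > 0" "j + 1 < j + CHAR('k)" using degree_pos p_ge_2 by auto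
    then have "(j + 1) * d < (j + CHAR('k)) * d" by (intro mult_strict_right_mono)
    then have "monomial (i, j + 1) \<in> pole_space (pole_order e)"
      using p_ge_2 by (intro small) (auto simp: e pole_order_def)
    moreover have "(\<lambda>x y. \<Sum>k<d. coeff g k * monomial (i + k, j) x y) \<in> pole_space (pole_order e)"
    proof (intro pole_space_sum pole_space_scale small)
      fix k assume "k \<in> {..<d}"
      then have "k * CHAR('k) < d * CHAR('k)" using p0 by simp
      then show "pole_order (i + k, j) < pole_order e" by (simp add: e pole_order_def algebra_simps)
    qed (use p0 in \<open>auto simp: e\<close>)
    moreover have "(\<lambda>x y. lead_coeff g * (monomial (i + d, j) x y - u * monomial e' x y)) \<in> pole_space (pole_order e)"
      using u(4) unfolding order_top by (rule pole_space_scale)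
    ultimately have "(\<lambda>x y. monomial (i, j + 1) x y + (\<Sum>k<d. coeff g k * monomial (i + k, j) x y)
      + lead_coeff g * (monomial (i + d, j) x y - u * monomial e' x y)) \<in> pole_space (pole_order e)"
      by (intro pole_space_add)
    then have "(\<lambda>x y. monomial e x y - (lead_coeff g * u) * monomial e' x y) \<in> pole_space (pole_order e)"
      by (rule pole_space_cong) (simp add: expand algebra_simps)
    moreover have "lead_coeff g * u \<noteq> 0" using u(1) degree_pos by auto
    ultimately show ?thesis using u(2,3) order_top
      by (intro exI[of _ "lead_coeff g * u"] exI[of _ e'] conjI) simp_all
  qed
qed

lemma monomial_in_pole_space:
  assumes "pole_order e < W" shows "monomial e \<in> pole_space W"
proof -
  obtain u e' where u: "snd e' < CHAR('k)" "pole_order e' = pole_order e" "(\<lambda>x y. monomial e x y - u * monomial e' x y) \<in> pole_space (pole_order e)"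
    using monomial_leading_term by blast
  have "(\<lambda>x y. monomial e x y - u * monomial e' x y) \<in> pole_space W"
    using u(3) pole_space_mono[of "pole_order e" W] assms by auto
  moreover have "monomial e' \<in> pole_space W" using u assms by (intro reduced_monomial_in_pole_space) auto
  ultimately show ?thesis by (rule pole_space_cong[OF pole_space_add[OF _ pole_space_scale]]) auto
qed

text \<open>
  The exponents of the product of the \<open>r\<close>-th power of one monomial with another monomial.
\<close>

definition frob_comb :: "nat \<Rightarrow> nat \<times> nat \<Rightarrow> nat \<times> nat \<Rightarrow> nat \<times> nat" where
  "frob_comb r s t = (r * fst s + fst t, r * snd s + snd t)"

lemma monomial_frob_comb: "monomial (frob_comb r s t) x y = monomial s x y ^ r * monomial t x y"
  by (simp add: monomial_def frob_comb_def power_add power_mult_distrib mult_ac flip: power_mult)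

lemma pole_order_frob_comb: "pole_order (frob_comb r s t) = r * pole_order s + pole_order t"
  by (simp add: pole_order_def frob_comb_def algebra_simps)

text \<open>
  The fibre over \<open>x\<close> is a translate of the prime field.
\<close>

lemma card_fibre:
  assumes "on_curve x y"
  shows "card {y. on_curve x y} = CHAR('k)" "finite {y. on_curve x y}"
proof -
  have eq: "{y'. on_curve x y'} = (+) y ` GF 1"
  proof (intro equalityI subsetI)
    fix y' assume "y' \<in> {y'. on_curve x y'}"
    then have "(y' - y) ^ CHAR('k) = y' - y"
      using assms frobenius_diff[of y' y 1] by (simp add: on_curve_def algebra_simps)
    then show "y' \<in> (+) y ` GF 1" by (intro image_eqI[of _ _ "y' - y"]) (auto simp: GF_def)
  next
    fix y' assume "y' \<in> (+) y ` GF 1"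
    then obtain c where "y' = y + c" "c ^ CHAR('k) = c" by (auto simp: GF_def)
    then show "y' \<in> {y'. on_curve x y'}"
      using assms frobenius_add[of y c 1] by (simp add: on_curve_def)
  qed
  show "finite {y. on_curve x y}" unfolding eq by (intro finite_imageI card_GF) simp
  have "card {y. on_curve x y} = card (GF 1 :: 'k set)"
    unfolding eq by (intro card_image) auto
  then show "card {y. on_curve x y} = CHAR('k)" using card_GF(1)[where 'k='k, of 1] by simp
qed

text \<open>
  A function on the curve, in reduced form, that vanishes on a whole fibre with its \<open>p\<close> points vanishes there as a
  polynomial in \<open>y\<close>, since its degree is below \<open>p\<close>.  So each of its coefficients, a polynomial in \<open>x\<close>, is zero at the base point.  The coefficient that carries the
  leading monomial is a nonzero polynomial of degree \<open>fst e0\<close>, which bounds the number of fibres.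
\<close>

lemma card_common_zeros_le:
  assumes c: "c \<noteq> 0" and e0: "snd e0 < CHAR('k)" and h: "(\<lambda>x y. H x y - c * monomial e0 x y) \<in> pole_space (pole_order e0)"
    and zero: "\<And>x y. x \<in> Z \<Longrightarrow> on_curve x y \<Longrightarrow> H x y = 0"
    and ex: "\<And>x. x \<in> Z \<Longrightarrow> \<exists>y. on_curve x y"
  shows "CHAR('k) * card Z \<le> pole_order e0"
proof -
  obtain a where a: "\<And>x y. on_curve x y \<Longrightarrow> H x y - c * monomial e0 x y = (\<Sum>e\<in>reduced_exps (pole_order e0). a e * monomial e x y)"
    using h by (auto simp: pole_space_def)
  define M where "M = reduced_exps (pole_order e0)"
  define R where "R = monom c (fst e0) + (\<Sum>e\<in>{e\<in>M. snd e = snd e0}. monom (a e) (fst e))"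
  have fM: "finite M" by (simp add: M_def finite_reduced_exps)
  have Rx: "poly R x = 0" if "x \<in> Z" for x
  proof -
    define Q where "Q = monom (c * x ^ fst e0) (snd e0) + (\<Sum>e\<in>M. monom (a e * x ^ fst e) (snd e))"
    have "poly Q y = 0" if "on_curve x y" for y
    proof -
      have "poly Q y = c * monomial e0 x y + (\<Sum>e\<in>M. a e * monomial e x y)"
        by (simp add: Q_def poly_sum poly_monom monomial_def mult.assoc)
      also have "\<dots> = H x y" using a[OF that] by (simp add: M_def algebra_simps)
      finally show ?thesis using zero[OF \<open>x \<in> Z\<close> that] by simp
    qed
    then have sub: "{y. on_curve x y} \<subseteq> {y. poly Q y = 0}" by blast
    have degQ: "degree Q < CHAR('k)"
      unfolding Q_def using e0 p_ge_2 
      by (intro degree_add_less degree_sum_less) (auto simp: M_def reduced_exps_def intro: le_less_trans[OF degree_monom_le])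
    have "Q = 0"
    proof (rule ccontr)
      assume "Q \<noteq> 0"
      obtain y where "on_curve x y" using ex \<open>x \<in> Z\<close> by blast
      then have "CHAR('k) \<le> card {y. poly Q y = 0}"
        using card_fibre card_mono[OF poly_roots_finite[OF \<open>Q \<noteq> 0\<close>] sub] by simp
      also have "\<dots> \<le> degree Q" using \<open>Q \<noteq> 0\<close> by (rule poly_roots_degree)
      finally show False using degQ by simp
    qed
    have "poly R x = c * x ^ fst e0 + (\<Sum>e\<in>{e\<in>M. snd e = snd e0}. a e * x ^ fst e)"
      by (simp add: R_def poly_sum poly_monom)
    also have "\<dots> = c * x ^ fst e0 + (\<Sum>e\<in>M. if snd e = snd e0 then a e * x ^ fst e else 0)"
      unfolding sum.inter_filter[OF fM] ..
    also have "\<dots> = coeff Q (snd e0)"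
      by (simp add: Q_def coeff_sum)
    also have "\<dots> = 0" using \<open>Q = 0\<close> by simp
    finally show ?thesis .
  qed
  have lower: "fst e < fst e0" if "e \<in> M" "snd e = snd e0" for e
    using that p_ge_2 by (auto simp: M_def reduced_exps_def pole_order_def)
  have cR: "coeff R (fst e0) = c"
  proof -
    have "(\<Sum>e\<in>{e\<in>M. snd e = snd e0}. coeff (monom (a e) (fst e)) (fst e0)) = 0"
      using lower by (intro sum.neutral) fastforce
    then show ?thesis by (simp add: R_def coeff_sum)
  qed
  then have "R \<noteq> 0" using c by auto
  have "degree (monom (a e) (fst e)) \<le> fst e0" if "e \<in> {e\<in>M. snd e = snd e0}" for e
    using degree_monom_le[of "a e" "fst e"] lower[of e] that by simp
  then have "degree R \<le> fst e0" unfolding R_def using fM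
    by (intro degree_add_le degree_sum_le degree_monom_le) auto
  moreover have "card Z \<le> card {x. poly R x = 0}"
    using Rx by (intro card_mono poly_roots_finite \<open>R \<noteq> 0\<close>) auto
  ultimately have "card Z \<le> fst e0"
    using poly_roots_degree[OF \<open>R \<noteq> 0\<close>] by linarith
  then have "CHAR('k) * card Z \<le> CHAR('k) * fst e0" by (rule mult_le_mono2)
  then show ?thesis unfolding pole_order_def by (metis mult.commute trans_le_add1)
qed

text \<open>
  Let \<open>q = r^2\<close>.  For functions \<open>s\<close> of pole order below \<open>r\<close> and \<open>t\<close> of pole order below \<open>m\<close>, the
  products \<open>s^r * t\<close> are so numerous, compared with the dimension of the space that contains them, that
  they satisfy a nontrivial linear relation on the curve.  At a point with coordinates in the field with \<open>q\<close>
  elements, \<open>t = t^q\<close>, and the relation becomes the \<open>r\<close>-th power of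
  the sum \<open>H\<close> of the \<open>\<gamma> * s * t^r\<close>, where \<open>\<gamma>^r\<close> are the coefficients of the relation.  So \<open>H\<close> vanishes at all these points.
  It is not the zero function: the pole orders of the products \<open>s * t^r\<close> are distinct, since
  their residues modulo \<open>r\<close> are the pole orders of \<open>s\<close>.  Counting zeros of \<open>H\<close> gives the bound.
\<close>

theorem bombieri_bound:
  assumes r: "r = CHAR('k) ^ \<mu>" and large: "r > G\<^sup>2 + 3 * G + 1" and G: "G = (CHAR('k) - 1) * d"
    and Z: "\<And>x. x \<in> Z \<Longrightarrow> x \<in> GF (2 * \<mu>)"
    and rational: "\<And>x y. x \<in> Z \<Longrightarrow> on_curve x y \<Longrightarrow> y \<in> GF (2 * \<mu>)"
    and ex: "\<And>x. x \<in> Z \<Longrightarrow> \<exists>y. on_curve x y"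
  shows "CHAR('k) * card Z \<le> r * (r + 2 * G + 1)"
proof -
  \<comment> \<open>The value of m is the smallest of the form r + const for which unknowns outnumber equations once r is large.\<close>
  define m where "m = r + 2 * G + 1"
  define S T E where "S = reduced_exps r" and "T = reduced_exps m" and "E = reduced_exps (r * r + 2 * G + 1)"
  have fin: "finite S" "finite T" "finite E" by (simp_all add: S_def T_def E_def finite_reduced_exps)
  have "r - G \<le> card S" "r + G + 1 \<le> card T"
    using card_reduced_exps_ge[of r] card_reduced_exps_ge[of m] unfolding G[symmetric] S_def T_def m_def by linarith+
  then have ST: "(r - G) * (r + G + 1) \<le> card (S \<times> T)"
    unfolding card_cartesian_product by (rule mult_mono) auto
  have "G \<le> r" using large by (simp add: power2_eq_square)
  then have "int ((r - G) * (r + G + 1)) = int r * int r + int r - int G * int G - int G"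
    unfolding of_nat_mult of_nat_diff[OF \<open>G \<le> r\<close>] by (simp add: algebra_simps)
  moreover have "int r > int G * int G + 3 * int G + 1"
    using large by (simp add: power2_eq_square flip: of_nat_mult of_nat_add)
  ultimately have "int (r * r + 2 * G + 1) < int ((r - G) * (r + G + 1))" by simp
  \<comment> \<open>More unknown coefficients than equations.\<close>
  then have card_lt: "card E < card (S \<times> T)"
    using ST card_reduced_exps_le[of "r * r + 2 * G + 1"] unfolding E_def by linarith
  have "\<forall>st\<in>S \<times> T. \<exists>a. \<forall>x y. on_curve x y \<longrightarrow> monomial (frob_comb r (fst st) (snd st)) x y = (\<Sum>e\<in>E. a e * monomial e x y)"
  proof
    fix st assume "st \<in> S \<times> T"
    then obtain s t where st: "st = (s, t)" "pole_order s < r" "pole_order t < m" by (auto simp: S_def T_def reduced_exps_def)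
    have "r * pole_order s \<le> r * (r - 1)" using st by (intro mult_left_mono) auto
    moreover have "r * (r - 1) + r = r * r" using st by (cases r) auto
    ultimately have "pole_order (frob_comb r s t) < r * r + 2 * G + 1"
      using st unfolding pole_order_frob_comb m_def by linarith
    then have "monomial (frob_comb r s t) \<in> pole_space (r * r + 2 * G + 1)" by (rule monomial_in_pole_space)
    then show "\<exists>a. \<forall>x y. on_curve x y \<longrightarrow> monomial (frob_comb r (fst st) (snd st)) x y = (\<Sum>e\<in>E. a e * monomial e x y)"
      by (simp add: pole_space_def st E_def)
  qed
  from bchoice[OF this] obtain A where A: "\<forall>st\<in>S \<times> T. \<forall>x y. on_curve x y \<longrightarrow>
      monomial (frob_comb r (fst st) (snd st)) x y = (\<Sum>e\<in>E. A st e * monomial e x y)"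
    by (elim exE)
  obtain c where c: "\<exists>st\<in>S \<times> T. c st \<noteq> 0" "\<And>e. e \<in> E \<Longrightarrow> (\<Sum>st\<in>S \<times> T. c st * A st e) = 0"
    using underdetermined_system_nontrivial_solution[OF fin(3) _ card_lt, of A] fin by auto
  have rel: "(\<Sum>st\<in>S \<times> T. c st * (monomial (fst st) x y ^ r * monomial (snd st) x y)) = 0" if "on_curve x y" for x y
  proof -
    have "(\<Sum>st\<in>S \<times> T. c st * (monomial (fst st) x y ^ r * monomial (snd st) x y))
        = (\<Sum>st\<in>S \<times> T. \<Sum>e\<in>E. c st * A st e * monomial e x y)"
      using A that by (intro sum.cong refl) (simp only: sum_distrib_left mult.assoc monomial_frob_comb[symmetric])
    also have "\<dots> = (\<Sum>e\<in>E. (\<Sum>st\<in>S \<times> T. c st * A st e) * monomial e x y)"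
      by (subst sum.swap) (simp add: sum_distrib_right)
    also have "\<dots> = 0" by (simp add: c(2))
    finally show ?thesis .
  qed
  have r0: "r > 0" using large by simp
  have "\<forall>st. \<exists>\<gamma>. \<gamma> ^ r = c st" by (intro allI nth_root_exists[OF r0])
  from choice[OF this] obtain \<gamma> where \<gamma>: "\<And>st. \<gamma> st ^ r = c st" by blast
  define H where "H = (\<lambda>x y. \<Sum>st\<in>S \<times> T. \<gamma> st * (monomial (fst st) x y * monomial (snd st) x y ^ r))"
  have H0: "H x y = 0" if x: "x \<in> Z" and xy: "on_curve x y" for x y
  proof -
    have fix_t: "(monomial t x y ^ r) ^ r = monomial t x y" for t
    proof -
      have "monomial t x y \<in> GF (2 * \<mu>)"
        unfolding monomial_def by (intro GF_mult GF_power Z rational[OF x xy] x)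
      then show ?thesis unfolding GF_def r mem_Collect_eq frobenius_frobenius mult_2 .
    qed
    have "H x y ^ r = (\<Sum>st\<in>S \<times> T. (\<gamma> st * (monomial (fst st) x y * monomial (snd st) x y ^ r)) ^ r)"
      unfolding H_def r by (rule frobenius_sum)
    also have "\<dots> = (\<Sum>st\<in>S \<times> T. c st * (monomial (fst st) x y ^ r * monomial (snd st) x y))"
      by (simp only: power_mult_distrib \<gamma> fix_t)
    also have "\<dots> = 0" by (rule rel[OF xy])
    finally show ?thesis using r0 by simp
  qed
  define P where "P = {st \<in> S \<times> T. c st \<noteq> 0}"
  define v where "v = (\<lambda>st. pole_order (frob_comb r (snd st) (fst st)))"
  have fP: "finite P" "P \<noteq> {}" using fin c(1) by (auto simp: P_def)
  have injv: "inj_on v P"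
  proof (rule inj_onI)
    fix st st' assume P: "st \<in> P" "st' \<in> P" and "v st = v st'"
    then have eq: "r * pole_order (snd st) + pole_order (fst st) = r * pole_order (snd st') + pole_order (fst st')"
      by (simp add: v_def pole_order_frob_comb)
    have lt: "pole_order (fst st) < r" "pole_order (fst st') < r" using P by (auto simp: P_def S_def reduced_exps_def)
    have "pole_order (fst st) = pole_order (fst st')"
      using arg_cong[OF eq, of "\<lambda>n. n mod r"] lt by simp
    moreover from this eq r0 have "pole_order (snd st) = pole_order (snd st')" by simp
    ultimately have "fst st = fst st'" "snd st = snd st'"
      using inj_on_pole_order P by (auto simp: P_def S_def T_def reduced_exps_def elim!: inj_onD)
    then show "st = st'" by (simp add: prod_eq_iff)
  qed
  have "Max (v ` P) \<in> v ` P" using fP by (intro Max_in) auto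
  \<comment> \<open>The term of largest pole order cannot be cancelled by the others.\<close>
  then obtain st0 where st0: "st0 \<in> P" "v st0 = Max (v ` P)" by auto
  have top: "v st < v st0" if "st \<in> P - {st0}" for st
  proof -
    have "v st \<le> v st0" unfolding st0(2) using fP that by (intro Max_ge) auto
    moreover have "v st \<noteq> v st0" using inj_onD[OF injv, of st st0] that st0(1) by blast
    ultimately show ?thesis by simp
  qed
  define top_mon where "top_mon = frob_comb r (snd st0) (fst st0)"
  have Hsum: "H x y = \<gamma> st0 * monomial top_mon x y + (\<Sum>st\<in>P - {st0}. \<gamma> st * monomial (frob_comb r (snd st) (fst st)) x y)" for x y
  proof -
    have "H x y = (\<Sum>st\<in>P. \<gamma> st * (monomial (fst st) x y * monomial (snd st) x y ^ r))"
      unfolding H_def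
    proof (rule sum.mono_neutral_right)
      show "\<forall>st\<in>S \<times> T - P. \<gamma> st * (monomial (fst st) x y * monomial (snd st) x y ^ r) = 0"
      proof
        fix st assume "st \<in> S \<times> T - P"
        then have "\<gamma> st ^ r = 0" using \<gamma>[of st] by (simp add: P_def)
        then show "\<gamma> st * (monomial (fst st) x y * monomial (snd st) x y ^ r) = 0" by simp
      qed
    qed (use fin in \<open>auto simp: P_def\<close>)
    also have "\<dots> = (\<Sum>st\<in>P. \<gamma> st * monomial (frob_comb r (snd st) (fst st)) x y)"
      by (simp add: monomial_frob_comb mult.commute)
    finally show ?thesis using sum.remove[OF fP(1) st0(1)] by (simp add: top_mon_def)
  qed
  obtain u e0 where u: "u \<noteq> 0" "snd e0 < CHAR('k)" "pole_order e0 = pole_order top_mon"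
      "(\<lambda>x y. monomial top_mon x y - u * monomial e0 x y) \<in> pole_space (pole_order top_mon)"
    using monomial_leading_term by blast
  have "(\<lambda>x y. \<Sum>st\<in>P - {st0}. \<gamma> st * monomial (frob_comb r (snd st) (fst st)) x y) \<in> pole_space (pole_order top_mon)"
    using top by (intro pole_space_sum pole_space_scale monomial_in_pole_space) (auto simp: v_def top_mon_def)
  then have "(\<lambda>x y. \<gamma> st0 * (monomial top_mon x y - u * monomial e0 x y)
      + (\<Sum>st\<in>P - {st0}. \<gamma> st * monomial (frob_comb r (snd st) (fst st)) x y)) \<in> pole_space (pole_order top_mon)"
    by (intro pole_space_add pole_space_scale u(4))
  then have red: "(\<lambda>x y. H x y - (\<gamma> st0 * u) * monomial e0 x y) \<in> pole_space (pole_order e0)"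
    unfolding u(3) by (rule pole_space_cong) (simp add: Hsum algebra_simps)
  have "\<gamma> st0 \<noteq> 0" using \<gamma>[of st0] st0(1) r0 by (auto simp: P_def zero_power)
  then have "CHAR('k) * card Z \<le> pole_order e0"
    using card_common_zeros_le[OF _ u(2) red H0 ex] u(1) by simp
  also have "pole_order e0 < r * m"
  proof -
    have "pole_order (fst st0) < r" "pole_order (snd st0) < m" using st0(1) by (auto simp: P_def S_def T_def reduced_exps_def)
    then have "r * pole_order (snd st0) + pole_order (fst st0) < r * (pole_order (snd st0) + 1)" "r * (pole_order (snd st0) + 1) \<le> r * m"
      by (simp, intro mult_left_mono, auto)
    then show ?thesis unfolding u(3) top_mon_def pole_order_frob_comb by linarith
  qed
  finally show ?thesis by (simp add: m_def)
qed

end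

section \<open>The L-function of an additive character sum\<close>

text \<open>
  The standard additive character of the prime field.  The choice of the representative
  does not matter on \<open>GF 1\<close>; outside \<open>GF 1\<close> the value is arbitrary.
\<close>

definition add_char :: "'k :: field_prime_char \<Rightarrow> complex" where
  "add_char x = cis (2 * pi * real (SOME k. of_nat k = x) / real CHAR('k))"

lemma cis_eq_if_cong:
  assumes "[a = b] (mod int p)" "p > 0"
  shows "cis (2 * pi * real_of_int a / real p) = cis (2 * pi * real_of_int b / real p)"
proof -
  obtain l where l: "a - b = int p * l" using assms(1) by (auto simp: cong_iff_dvd_diff)
  then have "real_of_int (a - b) = real p * real_of_int l"
    by (metis of_int_mult of_int_of_nat_eq)
  then have "2 * pi * real_of_int a / real p = 2 * pi * real_of_int b / real p + 2 * pi * real_of_int l"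
    using assms(2) by (simp add: field_simps)
  then show ?thesis by (simp flip: cis_mult)
qed

lemma add_char_of_nat:
  "add_char (of_nat k :: 'k :: field_prime_char) = cis (2 * pi * real k / real CHAR('k))"
proof -
  define k' where "k' = (SOME k'. of_nat k' = (of_nat k :: 'k))"
  have "of_nat k' = (of_nat k :: 'k)" unfolding k'_def by (rule someI) simp
  then have "[int k' = int k] (mod int CHAR('k))"
    by (simp add: of_nat_eq_iff_cong_CHAR cong_int_iff)
  from cis_eq_if_cong[OF this] show ?thesis
    by (simp add: add_char_def k'_def)
qed

lemma add_char_of_int:
  "add_char (of_int k :: 'k :: field_prime_char) = cis (2 * pi * real_of_int k / real CHAR('k))"
proof -
  define k' where "k' = nat (k mod int CHAR('k))"
  have p0: "int CHAR('k) > 0" by simp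
  have k': "int k' = k mod int CHAR('k)" using p0 by (simp add: k'_def)
  then have cong: "[int k' = k] (mod int CHAR('k))" by (simp add: Cong.cong_def)
  then have "(of_int k :: 'k) = of_int (int k')" unfolding of_int_eq_iff_cong_CHAR by (rule cong_sym)
  then have "add_char (of_int k :: 'k) = add_char (of_nat k' :: 'k)" by simp
  then show ?thesis using cis_eq_if_cong[OF cong] by (simp add: add_char_of_nat)
qed

lemma norm_add_char [simp]: "cmod (add_char x) = 1"
  by (simp add: add_char_def)

lemma add_char_add:
  fixes x y :: "'k :: {alg_closed_field, field_prime_char}"
  assumes "x \<in> GF 1" "y \<in> GF 1"
  shows "add_char (x + y) = add_char x * add_char y"
proof -
  obtain a b where ab: "x = of_nat a" "y = of_nat b"
    using assms unfolding prime_field_eq_of_nat by blast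
  have "x + y = of_nat (a + b)" by (simp add: ab)
  then have "add_char (x + y) = cis (2 * pi * real (a + b) / real CHAR('k))"
    by (simp only: add_char_of_nat)
  then show ?thesis by (simp add: ab add_char_of_nat cis_mult add_divide_distrib ring_distribs)
qed

lemma add_char_0 [simp]: "add_char (0 :: 'k :: field_prime_char) = 1"
  using add_char_of_nat[of 0, where 'k='k] by simp

lemma add_char_1_neq_1: "add_char (1 :: 'k :: field_prime_char) \<noteq> 1"
proof
  assume "add_char (1 :: 'k) = 1"
  then have "cis (2 * pi / real CHAR('k)) = 1" using add_char_of_nat[of 1, where 'k='k] by simp
  then have "cos (2 * pi / real CHAR('k)) = 1" by (metis cis.sel(1) one_complex.sel(1))
  moreover have "CHAR('k) \<ge> 2" using prime_ge_2_nat[OF CHAR_prime] .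
  then have "cos (2 * pi / real CHAR('k)) < cos 0"
    by (intro cos_monotone_0_pi) (auto simp: field_simps)
  ultimately show False by simp
qed

text \<open>
  Frobenius-stable multisets correspond to the monic polynomials over the prime field, by taking roots with multiplicity.
\<close>

definition frob_stable :: "'k :: field_prime_char multiset \<Rightarrow> bool" where
  "frob_stable D \<longleftrightarrow> image_mset (\<lambda>x. x ^ CHAR('k)) D = D"

definition stable_msets :: "nat \<Rightarrow> 'k :: field_prime_char multiset set" where
  "stable_msets k = {D. size D = k \<and> frob_stable D}"

text \<open>
  For \<open>x \<in> GF n\<close> this runs \<open>n / e\<close> times through the Frobenius orbit of \<open>x\<close>, where \<open>e\<close> is the length of
  the orbit.  Its sum is the trace of \<open>x\<close>.
\<close>

definition frob_orbit :: "nat \<Rightarrow> 'k \<Rightarrow> 'k :: field_prime_char multiset" where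
  "frob_orbit n x = image_mset (\<lambda>i. x ^ (CHAR('k) ^ i)) (mset_set {..<n})"

lemma frob_orbit_0 [simp]: "frob_orbit 0 x = {#}"
  by (simp add: frob_orbit_def)

lemma frob_orbit_Suc: "frob_orbit (Suc n) (x :: 'k :: field_prime_char) = add_mset (x ^ (CHAR('k) ^ n)) (frob_orbit n x)"
  by (simp add: frob_orbit_def lessThan_Suc)

lemma size_frob_orbit [simp]: "size (frob_orbit n x) = n"
  by (simp add: frob_orbit_def)

lemma frob_orbit_add:
  "frob_orbit (m + n) (x :: 'k :: field_prime_char) = frob_orbit m x + frob_orbit n (x ^ (CHAR('k) ^ m))"
  by (induction n) (simp_all add: frob_orbit_Suc frobenius_frobenius)

lemma frob_orbit_1: "frob_orbit 1 x = {#x#}"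
  by (simp add: frob_orbit_Suc)

lemma image_frob_orbit:
  "image_mset (\<lambda>x. x ^ CHAR('k)) (frob_orbit n x) = frob_orbit n (x ^ CHAR('k :: field_prime_char))"
  by (simp add: frob_orbit_def image_mset.compositionality o_def mult.commute flip: power_mult)

lemma frob_stable_orbit:
  assumes "(x :: 'k :: field_prime_char) \<in> GF n"
  shows "frob_stable (frob_orbit n x)"
proof -
  have "add_mset x (frob_orbit n (x ^ CHAR('k))) = frob_orbit (1 + n) x"
    unfolding frob_orbit_add frob_orbit_1 by simp
  also have "\<dots> = add_mset x (frob_orbit n x)"
    using assms by (simp add: frob_orbit_Suc GF_def)
  finally show ?thesis by (simp add: frob_stable_def image_frob_orbit)
qed

lemma frob_stable_add: "frob_stable D \<Longrightarrow> frob_stable D' \<Longrightarrow> frob_stable (D + D')"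
  by (simp add: frob_stable_def)

lemma frob_stable_diff: "frob_stable D \<Longrightarrow> frob_stable D' \<Longrightarrow> D' \<subseteq># D \<Longrightarrow> frob_stable (D - D')"
  by (simp add: frob_stable_def image_mset_Diff)

lemma frob_inj1: "inj (\<lambda>x. x ^ CHAR('k :: field_prime_char) :: 'k)"
  using frobenius_inj[where 'k='k and n=1] by (auto simp: inj_def)

lemma count_image_mset_inj1: "inj h \<Longrightarrow> count (image_mset h D) (h x) = count D x"
  by (induction D) (auto dest: injD)

lemma count_frob_stable:
  assumes "frob_stable D"
  shows "count D (x ^ (CHAR('k) ^ i)) = count D (x :: 'k :: field_prime_char)"
proof (induction i)
  case (Suc i)
  have "x ^ (CHAR('k) ^ Suc i) = (x ^ (CHAR('k) ^ i)) ^ CHAR('k)"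
    by (simp add: mult.commute flip: power_mult)
  then have "count D (x ^ (CHAR('k) ^ Suc i)) = count (image_mset (\<lambda>x. x ^ CHAR('k)) D) ((x ^ (CHAR('k) ^ i)) ^ CHAR('k))"
    using assms by (simp only: frob_stable_def)
  also have "\<dots> = count D (x ^ (CHAR('k) ^ i))"
    by (rule count_image_mset_inj1[OF frob_inj1])
  finally show ?case using Suc by simp
qed simp

text \<open>
  A stable multiset contains all points of the orbit of \<open>x\<close> with the same multiplicity, so it contains \<open>m\<close>
  copies of the orbit iff \<open>m \<le> count D x\<close>; and \<open>x \<in> GF n\<close> iff \<open>n\<close> is a multiple of the orbit length \<open>e\<close>.
\<close>

lemma card_orbits_in_stable_mset:
  fixes D :: "'k :: {alg_closed_field, field_prime_char} multiset"
  assumes D: "frob_stable D" and x: "x \<in># D"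
  shows "card {n. n \<ge> 1 \<and> x \<in> GF n \<and> frob_orbit n x \<subseteq># D} = count D x"
    and "\<exists>n. 1 \<le> n \<and> n \<le> size D \<and> x \<in> GF n"
    and "finite {n. n \<ge> 1 \<and> x \<in> GF n \<and> frob_orbit n x \<subseteq># D}"
proof -
  have "range (\<lambda>i. x ^ (CHAR('k) ^ i)) \<subseteq> set_mset D"
    using count_frob_stable[OF D, of x] x by (auto simp flip: count_greater_zero_iff)
  then have "finite (range (\<lambda>i. x ^ (CHAR('k) ^ i)))" by (rule finite_subset) simp
  then have "\<not> inj (\<lambda>i. x ^ (CHAR('k) ^ i))" using finite_imageD by blast
  then obtain i j where ij: "i < j" "x ^ (CHAR('k) ^ i) = x ^ (CHAR('k) ^ j)"
    unfolding inj_def by (metis linorder_neqE_nat)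
  then have "x ^ (CHAR('k) ^ i) = (x ^ (CHAR('k) ^ (j - i))) ^ (CHAR('k) ^ i)"
    by (simp only: frobenius_frobenius) simp
  then have "x \<in> GF (j - i)" by (simp only: frobenius_inj GF_def mem_Collect_eq)
  then have ex: "\<exists>n. n \<ge> 1 \<and> x \<in> GF n" using ij by (intro exI[of _ "j - i"]) auto
  define e where "e = (LEAST n. n \<ge> 1 \<and> x \<in> GF n)"
  have e: "e \<ge> 1" "x \<in> GF e" using LeastI_ex[OF ex] by (auto simp: e_def)
  \<comment> \<open>The number e is the length of the Frobenius orbit of x.\<close>
  have least: "e \<le> n" if "n \<ge> 1" "x \<in> GF n" for n using that by (auto simp: e_def intro: Least_le)
  have dvd_iff: "x \<in> GF n \<longleftrightarrow> e dvd n" for n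
  proof
    assume n: "x \<in> GF n"
    have "x = x ^ (CHAR('k) ^ (e * (n div e) + n mod e))" using n by (simp add: GF_def)
    also have "\<dots> = (x ^ (CHAR('k) ^ (e * (n div e)))) ^ (CHAR('k) ^ (n mod e))"
      by (simp only: frobenius_frobenius)
    also have "x ^ (CHAR('k) ^ (e * (n div e))) = x"
      using GF_mono_dvd[OF dvd_triv_left e(2), of "n div e"] by (simp add: GF_def)
    finally have "x \<in> GF (n mod e)" by (simp add: GF_def)
    then have "\<not> n mod e \<ge> 1" using least[of "n mod e"] e(1) mod_less_divisor[of e n] by linarith
    then show "e dvd n" by (simp add: dvd_eq_mod_eq_0)
  qed (use e in \<open>auto intro: GF_mono_dvd\<close>)
  have inj: "inj_on (\<lambda>i. x ^ (CHAR('k) ^ i)) {..<e}"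
  proof (rule linorder_inj_onI)
    fix i j assume ij: "i < j" "i \<in> {..<e}" "j \<in> {..<e}"
    show "x ^ (CHAR('k) ^ i) \<noteq> x ^ (CHAR('k) ^ j)"
    proof
      assume "x ^ (CHAR('k) ^ i) = x ^ (CHAR('k) ^ j)"
      then have "x ^ (CHAR('k) ^ i) = (x ^ (CHAR('k) ^ (j - i))) ^ (CHAR('k) ^ i)"
        using ij by (simp only: frobenius_frobenius) simp
      then have "x \<in> GF (j - i)" by (simp only: frobenius_inj GF_def mem_Collect_eq)
      then have "e \<le> j - i" using ij by (intro least) auto
      then show False using ij by auto
    qed
  qed auto
  define B where "B = (\<lambda>i. x ^ (CHAR('k) ^ i)) ` {..<e}"
  have orb_e: "frob_orbit e x = mset_set B"
    unfolding frob_orbit_def B_def using inj by (rule image_mset_mset_set)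
  have xB: "x \<in> B" using e(1) by (auto simp: B_def intro!: image_eqI[of _ _ 0])
  have cB: "count D y = count D x" if "y \<in> B" for y
    using that count_frob_stable[OF D] by (auto simp: B_def)
  have orb: "frob_orbit (m * e) x = repeat_mset m (mset_set B)" for m
  proof (induction m)
    case (Suc m)
    have "x ^ (CHAR('k) ^ (m * e)) = x" using GF_mono_dvd[OF dvd_triv_right e(2), of m] by (simp add: GF_def)
    then show ?case using Suc frob_orbit_add[of "m * e" e x] by (simp add: orb_e add.commute)
  qed simp
  have sub: "frob_orbit (m * e) x \<subseteq># D \<longleftrightarrow> m \<le> count D x" for m
  proof
    assume "frob_orbit (m * e) x \<subseteq># D"
    then have "count (repeat_mset m (mset_set B)) x \<le> count D x" unfolding orb by (rule mset_subset_eq_count)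
    then show "m \<le> count D x" using xB by (simp add: B_def)
  next
    assume m: "m \<le> count D x"
    show "frob_orbit (m * e) x \<subseteq># D" unfolding orb
      by (rule mset_subset_eqI) (use m cB in \<open>auto simp: count_mset_set'\<close>)
  qed
  have eq: "{n. n \<ge> 1 \<and> x \<in> GF n \<and> frob_orbit n x \<subseteq># D} = (\<lambda>m. m * e) ` {1..count D x}"
  proof (intro equalityI subsetI)
    fix n assume "n \<in> {n. n \<ge> 1 \<and> x \<in> GF n \<and> frob_orbit n x \<subseteq># D}"
    moreover from this obtain m where "n = m * e" using dvd_iff by (auto elim: dvdE simp: mult.commute)
    ultimately show "n \<in> (\<lambda>m. m * e) ` {1..count D x}" using sub by (auto intro!: image_eqI[of _ _ m])
  next
    fix n assume "n \<in> (\<lambda>m. m * e) ` {1..count D x}"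
    then show "n \<in> {n. n \<ge> 1 \<and> x \<in> GF n \<and> frob_orbit n x \<subseteq># D}"
      using sub dvd_iff e(1) by auto
  qed
  have "inj_on (\<lambda>m. m * e) {1..count D x}" using e(1) by (auto simp: inj_on_def)
  then show "card {n. n \<ge> 1 \<and> x \<in> GF n \<and> frob_orbit n x \<subseteq># D} = count D x"
    unfolding eq by (simp add: card_image)
  show "finite {n. n \<ge> 1 \<and> x \<in> GF n \<and> frob_orbit n x \<subseteq># D}" unfolding eq by simp
  have "frob_orbit (1 * e) x \<subseteq># D" unfolding sub using x by simp
  then have "e \<le> size D" using size_mset_mono by fastforce
  then show "\<exists>n. 1 \<le> n \<and> n \<le> size D \<and> x \<in> GF n" using e by blast
qed

lemma finite_stable_msets: "finite (stable_msets k :: 'k :: {alg_closed_field, field_prime_char} multiset set)"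
proof -
  define U where "U = (\<Union>n\<in>{1..k}. GF n :: 'k set)"
  have "finite U" unfolding U_def by (auto intro: card_GF)
  have "stable_msets k \<subseteq> mset ` {xs. set xs \<subseteq> U \<and> length xs = k}"
  proof
    fix D :: "'k multiset" assume D: "D \<in> stable_msets k"
    obtain xs where xs: "mset xs = D" using ex_mset by blast
    have "set xs \<subseteq> U"
    proof
      fix x assume "x \<in> set xs"
      then obtain n where "1 \<le> n" "n \<le> k" "x \<in> GF n"
        using card_orbits_in_stable_mset(2)[of D x] D xs by (auto simp: stable_msets_def)
      then show "x \<in> U" by (auto simp: U_def)
    qed
    then show "D \<in> mset ` {xs. set xs \<subseteq> U \<and> length xs = k}"
      using D xs by (auto simp: stable_msets_def)
  qed
  then show ?thesis using finite_lists_length_eq[OF \<open>finite U\<close>] by (rule finite_subset[OF _ finite_imageI])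
qed

lemma frobenius_sum_mset:
  "(\<Sum>x\<in>#D. h x :: 'k :: field_prime_char) ^ CHAR('k) = (\<Sum>x\<in>#D. h x ^ CHAR('k))"
proof (induction D)
  case (add a D)
  then show ?case using frobenius_add[where n=1, of "h a" "\<Sum>x\<in>#D. h x"] by simp
qed (auto simp: zero_power)

lemma map_poly_frobenius_mult:
  "map_poly (\<lambda>x. x ^ CHAR('k)) (g * h) = map_poly (\<lambda>x. x ^ CHAR('k)) g * map_poly (\<lambda>x. x ^ CHAR('k)) (h :: 'k :: field_prime_char poly)"
  by (intro poly_eqI) (simp add: frobenius_sum[where n=1, simplified] coeff_map_poly coeff_mult power_mult_distrib zero_power)

lemma map_poly_frobenius_prod_linear:
  "map_poly (\<lambda>x. x ^ CHAR('k)) (\<Prod>a\<in>#D. [:-a, 1:]) = (\<Prod>a\<in>#image_mset (\<lambda>x. x ^ CHAR('k)) D. [:-a, 1 :: 'k :: field_prime_char:])"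
proof (induction D)
  case (add a D)
  have "map_poly (\<lambda>x. x ^ CHAR('k)) [:-a, 1:] = [:- (a ^ CHAR('k)), 1 :: 'k:]"
    using frobenius_uminus[of a 1] by (simp add: map_poly_pCons)
  with add show ?case by (simp add: map_poly_frobenius_mult del: mult_pCons_left)
qed (auto simp: map_poly_1)

lemma coeff_prod_linear_in_GF:
  assumes "frob_stable (D :: 'k :: field_prime_char multiset)"
  shows "coeff (\<Prod>a\<in>#D. [:-a, 1:]) i \<in> GF 1"
proof -
  have "map_poly (\<lambda>x. x ^ CHAR('k)) (\<Prod>a\<in>#D. [:-a, 1:]) = (\<Prod>a\<in>#D. [:-a, 1:])"
    unfolding map_poly_frobenius_prod_linear using assms by (simp only: frob_stable_def)
  from arg_cong[OF this, of "\<lambda>g. coeff g i"] show ?thesis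
    by (simp add: coeff_map_poly GF_def zero_power)
qed

lemma frob_stable_proots:
  fixes g :: "'k :: {alg_closed_field, field_prime_char} poly"
  assumes "lead_coeff g = 1" "\<And>i. coeff g i \<in> GF 1"
  shows "frob_stable (proots g)"
proof -
  have "map_poly (\<lambda>x. x ^ CHAR('k)) g = g"
    using assms(2) by (intro poly_eqI) (simp add: coeff_map_poly GF_def zero_power)
  then have "g = (\<Prod>a\<in>#image_mset (\<lambda>x. x ^ CHAR('k)) (proots g). [:-a, 1:])"
    using map_poly_frobenius_prod_linear[of "proots g"] monic_eq_prod_proots(1)[OF assms(1)] by simp
  then have "proots g = image_mset (\<lambda>x. x ^ CHAR('k)) (proots g)"
    by (metis proots_prod_linear)
  then show ?thesis by (simp add: frob_stable_def)
qed

text \<open>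
  A polynomial with coefficients in the prime field, regarded over the algebraic closure.
\<close>

locale prime_field_poly =
  fixes f :: "'k :: {alg_closed_field, field_prime_char} poly"
  assumes coeff_in_GF: "\<And>i. coeff f i \<in> GF 1"
begin

text \<open>
  In terms of the monic polynomial with root multiset \<open>D\<close>, this is the completely multiplicative function
  whose Euler product is the L-function.
\<close>

definition char_mset :: "'k multiset \<Rightarrow> complex" where
  "char_mset D = add_char (\<Sum>x\<in>#D. poly f x)"

definition char_coeff :: "nat \<Rightarrow> complex" where
  "char_coeff k = (\<Sum>D\<in>stable_msets k. char_mset D)"

definition char_sum :: "nat \<Rightarrow> complex" where
  "char_sum n = (\<Sum>x\<in>GF n. add_char (ftrace n (poly f x)))"

lemma sum_mset_in_GF:
  assumes "frob_stable D" shows "(\<Sum>x\<in>#D. poly f x) \<in> GF 1"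
proof -
  have "(\<Sum>x\<in>#D. poly f x) ^ CHAR('k) = (\<Sum>x\<in>#image_mset (\<lambda>x. x ^ CHAR('k)) D. poly f x)"
    using poly_frobenius[OF coeff_in_GF, where n=1]
    by (simp add: frobenius_sum_mset image_mset.compositionality o_def)
  then show ?thesis using assms by (simp add: frob_stable_def GF_def)
qed

lemma char_mset_add:
  "frob_stable D \<Longrightarrow> frob_stable D' \<Longrightarrow> char_mset (D + D') = char_mset D * char_mset D'"
  by (simp add: char_mset_def add_char_add[OF sum_mset_in_GF sum_mset_in_GF])

lemma char_mset_orbit: "char_mset (frob_orbit n x) = add_char (ftrace n (poly f x))"
  by (simp add: char_mset_def frob_orbit_def ftrace_def poly_frobenius[OF coeff_in_GF]
      image_mset.compositionality o_def sum_unfold_sum_mset)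

lemma char_coeff_0: "char_coeff 0 = 1"
proof -
  have "stable_msets 0 = {{#} :: 'k multiset}" by (auto simp: stable_msets_def frob_stable_def)
  then show ?thesis by (simp add: char_coeff_def char_mset_def)
qed

text \<open>
  The logarithmic derivative of the L-function, without an Euler product.  Both sides sum over the stable
  multisets \<open>D\<close> of size \<open>k\<close> together with a pair \<open>(n, x)\<close> such that \<open>frob_orbit n x\<close> is contained in \<open>D\<close>.  There are \<open>size D\<close>
  such pairs (\<open>card_orbits_in_stable_mset\<close>), which is the left-hand side; splitting \<open>D\<close>
  into the orbit and the rest gives the right-hand side.
\<close>

lemma char_coeff_recursion:
  "of_nat k * char_coeff k = (\<Sum>n=1..k. char_sum n * char_coeff (k - n))"
proof -
  define R where "R = (\<lambda>D::'k multiset. SIGMA x:set_mset D. {n. n \<ge> 1 \<and> x \<in> GF n \<and> frob_orbit n x \<subseteq># D})"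
  have R: "finite (R D)" "card (R D) = k" if "D \<in> stable_msets k" for D
  proof -
    have D: "frob_stable D" "size D = k" using that by (auto simp: stable_msets_def)
    have fin: "\<And>x. x \<in> set_mset D \<Longrightarrow> finite {n. n \<ge> 1 \<and> x \<in> GF n \<and> frob_orbit n x \<subseteq># D}"
      by (rule card_orbits_in_stable_mset(3)[OF D(1)])
    show "finite (R D)" unfolding R_def by (intro finite_SigmaI fin) auto
    have "card (R D) = (\<Sum>x\<in>set_mset D. card {n. n \<ge> 1 \<and> x \<in> GF n \<and> frob_orbit n x \<subseteq># D})"
      unfolding R_def using fin by (intro card_SigmaI) auto
    also have "\<dots> = (\<Sum>x\<in>set_mset D. count D x)"
      by (intro sum.cong refl card_orbits_in_stable_mset(1)[OF D(1)])
    finally show "card (R D) = k" using D(2) by (simp add: size_multiset_overloaded_eq)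
  qed
  define T where "T = (SIGMA n:{1..k}. (GF n :: 'k set) \<times> (stable_msets (k - n) :: 'k multiset set))"
  have "(\<Sum>n=1..k. char_sum n * char_coeff (k - n))
      = (\<Sum>n=1..k. \<Sum>(x, D)\<in>GF n \<times> stable_msets (k - n). char_mset (frob_orbit n x) * char_mset D)"
    by (simp add: char_sum_def char_coeff_def sum_product char_mset_orbit sum.cartesian_product)
  also have "\<dots> = (\<Sum>(n, x, D)\<in>T. char_mset (frob_orbit n x) * char_mset D)"
    unfolding T_def
    by (subst sum.Sigma) (auto intro!: finite_cartesian_product card_GF finite_stable_msets)
  also have "\<dots> = (\<Sum>(D, x, n)\<in>(SIGMA D:stable_msets k. R D). char_mset D)"
  proof (rule sum.reindex_bij_witness[where j = "\<lambda>(n, x, D). (frob_orbit n x + D, x, n)"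
        and i = "\<lambda>(D, x, n). (n, x, D - frob_orbit n x)"])
    fix a assume "a \<in> T"
    then obtain n x D where a: "a = (n, x, D)" "1 \<le> n" "n \<le> k" "x \<in> GF n" "frob_stable D" "size D = k - n"
      by (auto simp: T_def stable_msets_def)
    have st: "frob_stable (frob_orbit n x)" using a by (intro frob_stable_orbit)
    show "(case case a of (n, x, D) \<Rightarrow> (frob_orbit n x + D, x, n) of (D, x, n) \<Rightarrow> (n, x, D - frob_orbit n x)) = a"
      by (simp add: a)
    have "x \<in># frob_orbit n x" using a(2) by (auto simp: frob_orbit_def intro!: image_eqI[of _ _ 0])
    then show "(case a of (n, x, D) \<Rightarrow> (frob_orbit n x + D, x, n)) \<in> (SIGMA D:stable_msets k. R D)"
      using a st by (auto simp: stable_msets_def R_def frob_stable_add)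
    show "(case case a of (n, x, D) \<Rightarrow> (frob_orbit n x + D, x, n) of (D, x, n) \<Rightarrow> char_mset D) =
        (case a of (n, x, D) \<Rightarrow> char_mset (frob_orbit n x) * char_mset D)"
      using a st by (simp add: char_mset_add)
  next
    fix b assume "b \<in> (SIGMA D:stable_msets k. R D)"
    then obtain D x n where b: "b = (D, x, n)" "frob_stable D" "size D = k" "1 \<le> n" "x \<in> GF n" "frob_orbit n x \<subseteq># D"
      by (auto simp: stable_msets_def R_def)
    have "n \<le> k" using size_mset_mono[OF b(6)] b(3) by simp
    then show "(case b of (D, x, n) \<Rightarrow> (n, x, D - frob_orbit n x)) \<in> T"
      using b by (auto simp: T_def stable_msets_def size_Diff_submset intro!: frob_stable_diff frob_stable_orbit)
    show "(case case b of (D, x, n) \<Rightarrow> (n, x, D - frob_orbit n x) of (n, x, D) \<Rightarrow> (frob_orbit n x + D, x, n)) = b"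
      using b by simp
  qed
  also have "\<dots> = (\<Sum>D\<in>stable_msets k. \<Sum>(x, n)\<in>R D. char_mset D)"
    using R by (subst sum.Sigma) (auto intro: finite_stable_msets)
  also have "\<dots> = (\<Sum>D\<in>stable_msets k. of_nat k * char_mset D)"
    by (intro sum.cong refl) (simp add: R split_def)
  finally show ?thesis by (simp add: char_coeff_def sum_distrib_left)
qed

lemma power_sum_expansion:
  "(\<Sum>x\<in>#D. poly f x) = (\<Sum>j\<le>degree f. coeff f j * (\<Sum>x\<in>#D. x ^ j))"
  by (induction D) (simp_all add: poly_altdef algebra_simps sum.distrib)

text \<open>
  Adding \<open>b\<close> to the coefficient of \<open>X^j\<close>, seen on the roots.
\<close>

definition shift_roots :: "nat \<Rightarrow> 'k \<Rightarrow> 'k multiset \<Rightarrow> 'k multiset" where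
  "shift_roots j b D = proots ((\<Prod>a\<in>#D. [:-a, 1:]) + monom b j)"

lemma shift_roots:
  assumes D: "D \<in> stable_msets k" and b: "b \<in> GF 1" and j: "j < k"
  shows "shift_roots j b D \<in> stable_msets k"
    and "(\<Prod>a\<in>#shift_roots j b D. [:-a, 1:]) = (\<Prod>a\<in>#D. [:-a, 1:]) + monom b j"
proof -
  let ?g = "\<Prod>a\<in>#D. [:-a, 1:]" 
  have dg: "degree ?g = k" and lg: "lead_coeff ?g = 1" and st: "frob_stable D"
    using D degree_prod_linear(1)[of D] by (auto simp: stable_msets_def intro: degree_prod_linear(2))
  have deg: "degree (?g + monom b j) = k"
    using dg j degree_monom_le[of b j] by (subst degree_add_eq_left) auto
  have lc: "lead_coeff (?g + monom b j) = 1"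
    using lg dg j unfolding deg by simp
  have "coeff (?g + monom b j) i \<in> GF 1" for i
    using coeff_prod_linear_in_GF[OF st, of i] b by (auto simp: GF_add GF_0)
  then have "frob_stable (shift_roots j b D)"
    unfolding shift_roots_def using lc by (intro frob_stable_proots)
  then show "shift_roots j b D \<in> stable_msets k"
    using monic_eq_prod_proots(2)[OF lc] deg by (simp add: stable_msets_def shift_roots_def)
  show "(\<Prod>a\<in>#shift_roots j b D. [:-a, 1:]) = ?g + monom b j"
    using monic_eq_prod_proots(1)[OF lc] by (simp add: shift_roots_def)
qed

lemma shift_roots_inverse:
  assumes "D \<in> stable_msets k" "b \<in> GF 1" "j < k"
  shows "shift_roots j (- b) (shift_roots j b D) = D"
  unfolding shift_roots_def[of j "- b"] shift_roots(2)[OF assms]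
  by (simp add: proots_prod_linear flip: minus_monom)

text \<open>
  The coefficient of \<open>X^(k - d)\<close> is, up to sign, the \<open>d\<close>-th elementary symmetric function of the \<open>k\<close> roots.
  Changing it alone leaves the power sums of exponent less than \<open>d\<close> fixed and shifts the \<open>d\<close>-th one linearly.
\<close>

lemma char_mset_shift_roots:
  assumes D: "D \<in> stable_msets k" and b: "b \<in> GF 1" and d: "degree f \<ge> 1" "degree f \<le> k"
  shows "char_mset (shift_roots (k - degree f) b D) =
    add_char (- (lead_coeff f * of_nat (degree f) * b)) * char_mset D"
proof -
  let ?d = "degree f"
  define D' where "D' = shift_roots (k - ?d) b D"
  have lt: "k - ?d < k" using d by simp
  have D': "D' \<in> stable_msets k" unfolding D'_def by (rule shift_roots(1)[OF D b lt])
  define e e' where "e = coeff (\<Prod>a\<in>#D. [:1, -a:])" and "e' = coeff (\<Prod>a\<in>#D'. [:1, -a:])"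
  have sz: "size D = k" "size D' = k" using D D' by (auto simp: stable_msets_def)
  have ee: "e' i = e i + (if i = ?d then b else 0)" if "i \<le> k" for i
    using that d sz shift_roots(2)[OF D b lt]
    by (simp add: e_def e'_def coeff_prod_linear_reversed D'_def) auto
  have e0: "e 0 = 1" "e' 0 = 1"
    using degree_prod_linear(2)[of D] coeff_prod_linear_reversed[of 0 D] sz ee[of 0] d
    by (auto simp: e_def degree_prod_linear)
  have agree: "\<And>i. i < ?d \<Longrightarrow> e i = e' i" using ee d by auto
  have np: "newton_pair (\<lambda>i. \<Sum>a\<in>#D. a ^ i) e" "newton_pair (\<lambda>i. \<Sum>a\<in>#D'. a ^ i) e'"
    unfolding e_def e'_def by (rule newton_pair_power_sums)+
  have low: "(\<Sum>a\<in>#D. a ^ i) = (\<Sum>a\<in>#D'. a ^ i)" if "i < ?d" for i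
  proof (cases "i = 0")
    case True then show ?thesis using sz by simp
  next
    case False
    then show ?thesis using newton_pair_agree[OF np e0, of ?d i] agree that by simp
  qed
  have top: "(\<Sum>a\<in>#D'. a ^ ?d) = (\<Sum>a\<in>#D. a ^ ?d) - of_nat ?d * b"
    using newton_pair_first_difference[OF np e0 agree d(1)] ee[of ?d] d by (simp add: algebra_simps)
  have split: "{..?d} = insert ?d {..<?d}" by auto
  have "(\<Sum>x\<in>#D'. poly f x) = (\<Sum>x\<in>#D. poly f x) + - (lead_coeff f * of_nat ?d * b)"
  proof -
    define P where "P = (\<lambda>(E::'k multiset) j. \<Sum>x\<in>#E. x ^ j)"
    have P: "P D' ?d = P D ?d - of_nat ?d * b" "\<And>j. j < ?d \<Longrightarrow> P D' j = P D j"
      using low top by (simp_all only: P_def)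
    have "(\<Sum>x\<in>#E. poly f x) = (\<Sum>j<?d. coeff f j * P E j) + lead_coeff f * P E ?d" for E
      unfolding power_sum_expansion split by (simp add: P_def add.commute)
    then show ?thesis by (simp add: P right_diff_distrib mult.assoc)
  qed
  moreover have "(\<Sum>x\<in>#D. poly f x) \<in> GF 1" using D by (intro sum_mset_in_GF) (simp add: stable_msets_def)
  moreover have "- (lead_coeff f * of_nat ?d * b) \<in> GF 1"
    by (intro GF_uminus GF_mult coeff_in_GF GF_of_nat b)
  ultimately have "char_mset D' = char_mset D * add_char (- (lead_coeff f * of_nat ?d * b))"
    unfolding char_mset_def by (simp only: add_char_add)
  then show ?thesis by (simp add: D'_def mult.commute)
qed

text \<open>
  A shift by a suitable \<open>b\<close> permutes the stable multisets of size \<open>k\<close> and multiplies every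
  term by \<open>add_char 1\<close>, which is not \<open>1\<close>.
\<close>

lemma char_coeff_eq_0:
  assumes d: "degree f \<ge> 1" "coprime (degree f) CHAR('k)" and k: "degree f \<le> k"
  shows "char_coeff k = 0"
proof -
  let ?d = "degree f"
  have "(of_nat ?d :: 'k) \<noteq> 0"
    using d prime_gt_1_nat[OF CHAR_prime[where 'a='k]] by (auto simp: of_nat_eq_0_iff_char_dvd coprime_absorb_right)
  moreover have "lead_coeff f \<noteq> 0" using d by auto
  ultimately have nz: "lead_coeff f * of_nat ?d \<noteq> 0" by simp
  \<comment> \<open>Chosen so that the shift multiplies by the character value at 1.\<close>
  define b where "b = - (1 / (lead_coeff f * of_nat ?d))"
  have b: "b \<in> GF 1" unfolding b_def by (intro GF_uminus GF_divide GF_mult GF_1 coeff_in_GF GF_of_nat)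
  have lt: "k - ?d < k" using d k by simp
  have one: "- (lead_coeff f * of_nat ?d * b) = 1" using nz by (simp add: b_def)
  have "char_coeff k = (\<Sum>D\<in>stable_msets k. char_mset (shift_roots (k - ?d) b D))"
    unfolding char_coeff_def
  proof (rule sum.reindex_bij_witness[where i = "shift_roots (k - ?d) b" and j = "shift_roots (k - ?d) (- b)"])
    fix D :: "'k multiset" assume D: "D \<in> stable_msets k"
    show "shift_roots (k - ?d) (- b) D \<in> stable_msets k" "shift_roots (k - ?d) b D \<in> stable_msets k"
      using shift_roots(1)[OF D _ lt] b GF_uminus[OF b] by auto
    show "shift_roots (k - ?d) (- b) (shift_roots (k - ?d) b D) = D"
      "shift_roots (k - ?d) b (shift_roots (k - ?d) (- b) D) = D"
      using shift_roots_inverse[OF D b lt] shift_roots_inverse[OF D GF_uminus[OF b] lt] by auto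
    then show "char_mset (shift_roots (k - ?d) b (shift_roots (k - ?d) (- b) D)) = char_mset D" by simp
  qed
  also have "\<dots> = (\<Sum>D\<in>stable_msets k. add_char (1 :: 'k) * char_mset D)"
    using char_mset_shift_roots[OF _ b d(1) k] unfolding one by (intro sum.cong refl) auto
  also have "\<dots> = add_char (1 :: 'k) * char_coeff k" by (simp add: char_coeff_def sum_distrib_left)
  finally have "(add_char (1 :: 'k) - 1) * char_coeff k = 0" by (simp add: algebra_simps)
  then show ?thesis using add_char_1_neq_1[where 'k='k] by simp
qed

theorem char_sum_eq_power_sum:
  assumes d: "degree f \<ge> 1" "coprime (degree f) CHAR('k)"
  obtains W where "size W = degree f - 1" "\<And>n. n \<ge> 1 \<Longrightarrow> char_sum n = - (\<Sum>w\<in>#W. w ^ n)"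
proof (rule newton_pair_finite_support[of char_coeff "degree f - 1" char_sum])
  show "char_coeff 0 = 1" by (rule char_coeff_0)
  show "char_coeff k = 0" if "k > degree f - 1" for k
    using that by (intro char_coeff_eq_0 d) simp
  show "newton_pair (\<lambda>i. - char_sum i) char_coeff"
    using char_coeff_recursion by (simp add: newton_pair_def sum_negf)
qed (use that in auto)

end

section \<open>Weil's bound\<close>

lemma artin_schreier_solvable:
  "\<exists>y :: 'k :: {alg_closed_field, field_prime_char}. y ^ CHAR('k) - y = z"
proof -
  have p: "CHAR('k) \<ge> 2" using prime_ge_2_nat[OF CHAR_prime] .
  define h where "h = monom (1::'k) CHAR('k) + (- monom 1 1 - [:z:])"
  have "degree (- monom (1::'k) 1 - [:z:]) \<le> 1"
    by (intro degree_diff_le) (auto simp: degree_monom_eq)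
  then have "degree h = CHAR('k)"
    unfolding h_def using p by (subst degree_add_eq_left) (auto simp: degree_monom_eq)
  then obtain y where "poly h y = 0" using alg_closed_imp_poly_has_root[of h] p by auto
  then have "y ^ CHAR('k) - y = z" by (simp add: h_def poly_monom algebra_simps)
  then show ?thesis by blast
qed

lemma sum_add_char_eq_0: "(\<Sum>a\<in>(GF 1 :: 'k :: {alg_closed_field, field_prime_char} set). add_char a) = 0"
proof -
  have "(\<Sum>a\<in>(GF 1 :: 'k set). add_char a) = (\<Sum>a\<in>(GF 1 :: 'k set). add_char (a + 1))"
    by (rule sum.reindex_bij_witness[of _ "\<lambda>a. a + 1" "\<lambda>a. a - 1"])
       (auto intro: GF_add GF_diff GF_1)
  also have "\<dots> = (\<Sum>a\<in>(GF 1 :: 'k set). add_char a) * add_char (1 :: 'k)"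
    unfolding sum_distrib_right by (intro sum.cong refl add_char_add GF_1)
  finally have "(\<Sum>a\<in>(GF 1 :: 'k set). add_char a) * (add_char (1 :: 'k) - 1) = 0"
    by (simp add: algebra_simps)
  then show ?thesis using add_char_1_neq_1[where 'k='k] by simp
qed

context prime_field_poly
begin

text \<open>
  Subtracting from \<open>f\<close> its value at one point of the fibre reduces the claim to trace zero, where the points
  lift to rational points of an Artin-Schreier curve.
\<close>

lemma card_trace_fibre_le:
  assumes d: "degree f \<ge> 1" "coprime (degree f) CHAR('k)"
    and G: "G = (CHAR('k) - 1) * degree f" and large: "CHAR('k) ^ \<mu> > G\<^sup>2 + 3 * G + 1"
  shows "CHAR('k) * card {x \<in> GF (2 * \<mu>). ftrace (2 * \<mu>) (poly f x) = a}
    \<le> CHAR('k) ^ \<mu> * (CHAR('k) ^ \<mu> + 2 * G + 1)"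
proof (cases "{x \<in> GF (2 * \<mu>). ftrace (2 * \<mu>) (poly f x) = a} = {}")
  case False
  then obtain x0 where x0: "x0 \<in> GF (2 * \<mu>)" "ftrace (2 * \<mu>) (poly f x0) = a" by blast
  define g where "g = f + [:- poly f x0:]"
  have dg: "degree g = degree f" using d(1) unfolding g_def by (subst degree_add_eq_left) auto
  interpret artin_schreier g by unfold_locales (use d dg in auto)
  show ?thesis
  proof (rule bombieri_bound[OF refl large])
    show "G = (CHAR('k) - 1) * degree g" by (simp add: G dg)
    fix x assume x: "x \<in> {x \<in> GF (2 * \<mu>). ftrace (2 * \<mu>) (poly f x) = a}"
    then show "x \<in> GF (2 * \<mu>)" by simp
    show "\<exists>y. on_curve x y" unfolding on_curve_def by (rule artin_schreier_solvable)
    fix y assume "on_curve x y"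
    then have "y ^ CHAR('k) - y = poly g x" by (simp only: on_curve_def)
    then have "y ^ CHAR('k) - y = poly f x - poly f x0" by (simp add: g_def)
    then have "y ^ (CHAR('k) ^ (2 * \<mu>)) - y = 0"
      using x x0 ftrace_artin_schreier[of "2 * \<mu>" y] by (simp add: ftrace_diff)
    then show "y \<in> GF (2 * \<mu>)" by (simp add: GF_def)
  qed
next
  case True
  then show ?thesis by (simp only: card.empty mult_0_right zero_le)
qed

text \<open>
  Bombieri's bound is one-sided, but the trace fibres partition the field.  Hence the nonnegative deficits
  \<open>B - card (N a)\<close> have a small total, and replacing the sizes by the negated deficits does not change the character
  sum, since the character sums to zero over the prime field.
\<close>

lemma norm_char_sum_even_le:
  assumes d: "degree f \<ge> 1" "coprime (degree f) CHAR('k)"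
    and G: "G = (CHAR('k) - 1) * degree f" and large: "CHAR('k) ^ \<mu> > G\<^sup>2 + 3 * G + 1"
  shows "cmod (char_sum (2 * \<mu>)) \<le> (2 * real G + 1) * real CHAR('k) ^ \<mu>"
proof -
  define p where "p = CHAR('k)"
  define r where "r = real (p ^ \<mu>)"
  define N where "N = (\<lambda>a. {x \<in> GF (2 * \<mu>). ftrace (2 * \<mu>) (poly f x) = a})"
  define B where "B = r * (r + 2 * real G + 1) / real p"
  have p0: "p > 0" by (simp add: p_def)
  have "\<mu> \<noteq> 0" using large by (intro notI) simp
  then have GF: "card (GF (2 * \<mu>) :: 'k set) = p ^ (2 * \<mu>)" "finite (GF (2 * \<mu>) :: 'k set)"
    "card (GF 1 :: 'k set) = p" "finite (GF 1 :: 'k set)"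
    using card_GF[of "2 * \<mu>", where 'k='k] card_GF[of 1, where 'k='k] by (simp_all add: p_def)
  have le: "real (card (N a)) \<le> B" for a
  proof -
    have "real (p * card (N a)) \<le> real (p ^ \<mu> * (p ^ \<mu> + 2 * G + 1))"
      using card_trace_fibre_le[OF d G large, of a] unfolding p_def N_def of_nat_le_iff .
    then show ?thesis using p0 by (simp add: B_def r_def field_simps)
  qed
  have tr: "(\<lambda>x. ftrace (2 * \<mu>) (poly f x)) ` GF (2 * \<mu>) \<subseteq> GF 1"
    by (auto intro!: ftrace_in_prime_field poly_in_GF coeff_in_GF simp del: One_nat_def)
  have group: "(\<Sum>a\<in>GF 1. \<Sum>x\<in>N a. h x) = (\<Sum>x\<in>GF (2 * \<mu>). h x)" for h :: "'k \<Rightarrow> complex"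
    unfolding N_def by (rule sum.group[OF GF(2) GF(4) tr])
  have "char_sum (2 * \<mu>) = (\<Sum>a\<in>GF 1. \<Sum>x\<in>N a. add_char (ftrace (2 * \<mu>) (poly f x)))"
    unfolding char_sum_def group ..
  also have "\<dots> = (\<Sum>a\<in>GF 1. add_char a * of_real (real (card (N a))))"
    by (intro sum.cong refl) (simp add: N_def mult.commute)
  also have "\<dots> = - (\<Sum>a\<in>GF 1. add_char a * of_real (B - real (card (N a))))"
    using sum_add_char_eq_0[where 'k='k]
    by (simp add: algebra_simps sum_subtractf flip: sum_distrib_right sum_distrib_left)
  finally have "cmod (char_sum (2 * \<mu>)) \<le> (\<Sum>a\<in>(GF 1 :: 'k set). cmod (add_char a * of_real (B - real (card (N a)))))"
    by (simp only: norm_minus_cancel) (rule norm_sum)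
  also have "\<dots> = (\<Sum>a\<in>(GF 1 :: 'k set). B - real (card (N a)))"
    using le by (intro sum.cong refl) (simp add: norm_mult flip: of_real_diff)
  also have "\<dots> = real p * B - real (\<Sum>a\<in>(GF 1 :: 'k set). card (N a))"
    by (simp add: sum_subtractf GF GF(3)[unfolded One_nat_def])
  also have "(\<Sum>a\<in>(GF 1 :: 'k set). card (N a)) = p ^ (2 * \<mu>)"
  proof -
    have "of_nat (\<Sum>a\<in>(GF 1 :: 'k set). card (N a)) = (of_nat (p ^ (2 * \<mu>)) :: complex)"
      using group[of "\<lambda>_. 1"] GF by simp
    then show ?thesis by (simp only: of_nat_eq_iff)
  qed
  also have "real p * B - real (p ^ (2 * \<mu>)) = r * (r + 2 * real G + 1) - r * r"
  proof -
    have "real (p ^ (2 * \<mu>)) = r * r" unfolding r_def mult_2 power_add of_nat_mult ..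
    moreover have "real p * B = r * (r + 2 * real G + 1)" using p0 by (simp add: B_def)
    ultimately show ?thesis by simp
  qed
  also have "\<dots> = (2 * real G + 1) * r" by (simp add: algebra_simps)
  finally show ?thesis unfolding r_def p_def of_nat_power .
qed

theorem weil_bound:
  assumes d: "degree f \<ge> 1" "coprime (degree f) CHAR('k)"
  shows "cmod (\<Sum>x\<in>GF 1. add_char (poly f x)) \<le> (real (degree f) - 1) * sqrt (real CHAR('k))"
proof -
  obtain W where W: "size W = degree f - 1" "\<And>n. n \<ge> 1 \<Longrightarrow> char_sum n = - (\<Sum>w\<in>#W. w ^ n)"
    using char_sum_eq_power_sum[OF d] by blast
  define G where "G = (CHAR('k) - 1) * degree f"
  \<comment> \<open>Only even n = 2 * \<mu> are controlled, so the squares of the w are considered.\<close>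
  define W2 where "W2 = image_mset (\<lambda>w. w\<^sup>2) W"
  have p2: "CHAR('k) \<ge> 2" using prime_ge_2_nat[OF CHAR_prime] .
  have "cmod (\<Sum>w\<in>#W2. w ^ \<mu>) \<le> (2 * real G + 1) * real CHAR('k) ^ \<mu>" if "\<mu> \<ge> G\<^sup>2 + 3 * G + 2" for \<mu>
  proof -
    have "\<mu> < CHAR('k) ^ \<mu>" using p2 by (intro power_gt_expt) auto
    then have "G\<^sup>2 + 3 * G + 1 < CHAR('k) ^ \<mu>" using that by linarith
    from norm_char_sum_even_le[OF d G_def this] show ?thesis
      using that by (simp add: W W2_def image_mset.compositionality o_def flip: power_mult)
  qed
  then have "cmod (w\<^sup>2) \<le> real CHAR('k)" if "w \<in># W" for w
    using that by (intro power_sums_bounded_imp_le[of "real CHAR('k)" _ W2]) (auto simp: W2_def)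
  then have w: "cmod w \<le> sqrt (real CHAR('k))" if "w \<in># W" for w
    using that by (auto simp: norm_power intro!: real_le_rsqrt)
  have "(\<Sum>x\<in>GF 1. add_char (poly f x)) = char_sum 1"
    by (simp add: char_sum_def ftrace_def)
  also have "cmod \<dots> = cmod (\<Sum>w\<in>#W. w)" by (simp add: W)
  also have "\<dots> \<le> (\<Sum>w\<in>#W. cmod w)"
    by (induction W) (auto intro: order_trans[OF norm_triangle_ineq])
  also have "\<dots> \<le> (\<Sum>w\<in>#W. sqrt (real CHAR('k)))" by (intro sum_mset_mono w)
  also have "\<dots> = (real (degree f) - 1) * sqrt (real CHAR('k))" using d W by (simp add: of_nat_diff)
  finally show ?thesis .
qed

end

lemma coeff_reduce_mod: "coeff (reduce_mod p \<psi>) i = coeff \<psi> i mod int p"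
  by (simp add: reduce_mod_def coeff_map_poly)

lemma weil_bound_int:
  fixes \<psi> :: "int poly"
  assumes p: "p = CHAR('k :: {alg_closed_field, field_prime_char})"
    and d: "1 \<le> degree (reduce_mod p \<psi>)" "degree (reduce_mod p \<psi>) < p"
  shows "cmod (\<Sum>j<p. cis (2 * pi * real_of_int (poly \<psi> (int j)) / real p))
    \<le> (real (degree (reduce_mod p \<psi>)) - 1) * sqrt (real p)"
proof -
  define f where "f = map_poly (of_int :: int \<Rightarrow> 'k) \<psi>"
  have cf: "coeff f i = of_int (coeff \<psi> i)" for i by (simp add: f_def coeff_map_poly)
  have "coeff f i = 0 \<longleftrightarrow> coeff (reduce_mod p \<psi>) i = 0" for i
    unfolding cf coeff_reduce_mod of_int_eq_0_iff_char_dvd p by (simp add: dvd_eq_mod_eq_0)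
  then have deg: "degree f = degree (reduce_mod p \<psi>)" by (simp add: degree_def)
  interpret prime_field_poly f
  proof
    fix i show "coeff f i \<in> GF 1"
      unfolding cf using GF_of_nat GF_uminus[OF GF_of_nat] by (cases "coeff \<psi> i") (auto simp del: of_nat_Suc One_nat_def)
  qed
  have pr: "prime p" unfolding p by (rule CHAR_prime)
  have cop: "coprime (degree f) CHAR('k)"
    using pr d unfolding deg p[symmetric] by (metis coprime_commute dvd_imp_le leD less_eq_Suc_le prime_imp_coprime One_nat_def)
  have inj: "inj_on (of_nat :: nat \<Rightarrow> 'k) {..<p}"
    by (auto simp: inj_on_def p of_nat_eq_iff_cong_CHAR Cong.cong_def)
  have pf: "poly f (of_nat j) = of_int (poly \<psi> (int j))" for j
    using of_int_hom.poly_map_poly[of \<psi> "int j", where 'a='k] by (simp add: f_def)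
  have "(\<Sum>x\<in>GF 1. add_char (poly f x)) = (\<Sum>j<p. add_char (poly f (of_nat j)))"
    unfolding prime_field_eq_of_nat p[symmetric] by (subst sum.reindex[OF inj]) (simp only: o_def)
  also have "\<dots> = (\<Sum>j<p. cis (2 * pi * real_of_int (poly \<psi> (int j)) / real p))"
    by (simp only: pf add_char_of_int p)
  finally have eq: "(\<Sum>x\<in>GF 1. add_char (poly f x)) = (\<Sum>j<p. cis (2 * pi * real_of_int (poly \<psi> (int j)) / real p))" .
  have "degree f \<ge> 1" using d(1) deg by simp
  from weil_bound[OF this cop] show ?thesis unfolding eq deg p[symmetric] .
qed

text \<open>
  Weil's bound at \<open>p\<close> for polynomials whose reduced degree is less than \<open>p\<close>, in terms of
  integers only, so that the prime is an ordinary variable.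
\<close>

definition satisfies_weil :: "nat \<Rightarrow> bool" where
  "satisfies_weil p \<longleftrightarrow> (\<forall>\<psi>::int poly. 1 \<le> degree (reduce_mod p \<psi>) \<and> degree (reduce_mod p \<psi>) < p \<longrightarrow>
     cmod (\<Sum>j<p. cis (2 * pi * real_of_int (poly \<psi> (int j)) / real p))
       \<le> (real (degree (reduce_mod p \<psi>)) - 1) * sqrt (real p))"

text \<open>
  If Weil's bound failed at some prime, it would fail at this one.
\<close>

definition critical_prime :: nat where
  "critical_prime = (SOME p. prime p \<and> (satisfies_weil p \<longrightarrow> (\<forall>q. prime q \<longrightarrow> satisfies_weil q)))"

lemma critical_prime:
  "prime critical_prime" "satisfies_weil critical_prime \<Longrightarrow> prime q \<Longrightarrow> satisfies_weil q"
proof -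
  have "\<exists>p. prime (p::nat) \<and> (satisfies_weil p \<longrightarrow> (\<forall>q. prime q \<longrightarrow> satisfies_weil q))"
    using two_is_prime_nat by blast
  from someI_ex[OF this] show "prime critical_prime" "satisfies_weil critical_prime \<Longrightarrow> prime q \<Longrightarrow> satisfies_weil q"
    unfolding critical_prime_def by blast+
qed

text \<open>
  An index type with \<open>critical_prime\<close> elements; the integers modulo its cardinality are a field.
\<close>

typedef critical_index = "{..<critical_prime}"
  using prime_gt_0_nat[OF critical_prime(1)] by blast

lemma card_critical_index: "CARD(critical_index) = critical_prime"
  using type_definition.card[OF type_definition_critical_index] by simp

instance critical_index :: prime_card
  by standard (simp add: card_critical_index critical_prime)

instance alg_closure :: (field_prime_char) field_prime_char
  by (rule field_prime_charI') simp

text \<open>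
  At the critical prime there is a field of that characteristic to work in, and the critical prime settles all others.
\<close>

theorem weil_bound_prime:
  assumes "prime p" shows "satisfies_weil p"
proof (rule critical_prime(2)[OF _ assms])
  have "critical_prime = CHAR(critical_index mod_ring alg_closure)"
    by (simp add: card_critical_index)
  from weil_bound_int[OF this] show "satisfies_weil critical_prime"
    by (auto simp: satisfies_weil_def)
qed

section \<open>A cosecant sum\<close>

text \<open>
  The lowest Pade approximant of the logarithm at 1 gives numerical bounds that are sharp enough below.
\<close>

lemma ln_ge_pade:
  assumes "x \<ge> 1"
  shows "ln x \<ge> 2 * (x - 1) / (x + 1 :: real)"
proof -
  have "\<exists>y. ((\<lambda>t. ln t - 2 * (t - 1) / (t + 1)) has_real_derivative y) (at t) \<and> 0 \<le> y" if "1 \<le> t" "t \<le> x" for t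
  proof -
    have t: "t > 0" "t + 1 \<noteq> 0" using that by auto
    have "((\<lambda>t. ln t - 2 * (t - 1) / (t + 1)) has_real_derivative
        (1 / t - (2 * (t + 1) - 2 * (t - 1) * 1) / ((t + 1) * (t + 1)))) (at t)"
      using t by (auto intro!: derivative_eq_intros)
    moreover have "1 / t - (2 * (t + 1) - 2 * (t - 1) * 1) / ((t + 1) * (t + 1)) = (t - 1)\<^sup>2 / (t * (t + 1)\<^sup>2)"
      using t by (simp add: divide_simps) (simp add: power2_eq_square algebra_simps)
    moreover have "(t - 1)\<^sup>2 / (t * (t + 1)\<^sup>2) \<ge> 0" using t by simp
    ultimately show ?thesis by metis
  qed
  from DERIV_nonneg_imp_nondecreasing[OF assms this] show ?thesis by simp
qed

text \<open>
  The left-hand side is what the integral comparison yields for the cosecant sum.  Its logarithm has the factor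
  \<open>1/\<pi> < 4/\<pi>^2\<close>, so only \<open>x = 3\<close> has to be verified numerically, where
  little room is left.
\<close>

lemma log_comparison:
  assumes "x \<ge> 3"
  shows "2/3 + ln (2 * x / pi) / pi \<le> 4 / pi\<^sup>2 * ln (3 * x)"
proof -
  have pi: "pi > 314/100" "pi < 3142/1000" using pi_approx by simp_all
  have ln3: "ln 3 \<ge> (27/25 :: real)"
  proof -
    \<comment> \<open>The factors are close enough to 1 for the approximant.\<close>
    have "ln (3::real) = ln (3/2) + ln (4/3) + ln (3/2)" by (simp flip: ln_mult_pos)
    then show ?thesis using ln_ge_pade[of "3/2"] ln_ge_pade[of "4/3"] by simp
  qed
  have "43/100 \<le> ln (157/100 :: real)" using ln_ge_pade[of "157/100"] by simp
  also have "\<dots> \<le> ln (pi / 2)" using pi by (intro ln_mono) auto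
  finally have lnpi: "ln (pi / 2) \<ge> 43/100" .
  have x: "ln x \<ge> ln 3" using assms by simp
  have "(8 / pi - 1) * ln 3 \<ge> (8 / (3142/1000) - 1) * (27/25)"
    using pi ln3 by (intro mult_mono diff_right_mono divide_left_mono) (auto simp: field_simps)
  moreover have "2 * pi / 3 \<le> 2 * (3142/1000) / 3" using pi by simp
  ultimately have key: "2 * pi / 3 \<le> (8 / pi - 1) * ln 3 + ln (pi / 2)" using lnpi by simp
  have "(4 / pi - 1) * ln 3 \<le> (4 / pi - 1) * ln x"
    using x pi by (intro mult_left_mono) (auto simp: field_simps)
  then have "2 * pi / 3 \<le> (4 / pi - 1) * ln x + 4 / pi * ln 3 + ln (pi / 2)"
    using key by (simp add: algebra_simps)
  also have "\<dots> = 4 / pi * ln (3 * x) - ln (2 * x / pi)"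
    using assms by (simp add: ln_mult ln_div algebra_simps)
  finally have "(2 * pi / 3 + ln (2 * x / pi)) / pi \<le> (4 / pi * ln (3 * x)) / pi"
    by (intro divide_right_mono) auto
  then show ?thesis by (simp add: add_divide_distrib power2_eq_square)
qed

lemma sin_ge_on_0_pi_6:
  assumes "0 \<le> y" "y \<le> pi / 6"
  shows "sin y \<ge> 3 / pi * y"
proof -
  have "concave_on {0..pi/6} sin"
  proof (rule f''_le0_imp_concave)
    show "(sin has_real_derivative cos x) (at x)" for x by (auto intro!: derivative_eq_intros)
    show "(cos has_real_derivative - sin x) (at x)" for x by (auto intro!: derivative_eq_intros)
    show "- sin x \<le> 0" if "x \<in> {0..pi/6}" for x using that by (auto intro!: sin_ge_zero)
  qed auto
  then have "sin ((1 - 6 * y / pi) *\<^sub>R 0 + (6 * y / pi) *\<^sub>R (pi / 6)) \<ge> (1 - 6 * y / pi) * sin 0 + (6 * y / pi) * sin (pi / 6)"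
    using assms by (intro concave_onD) (auto simp: field_simps)
  then show ?thesis by (simp add: sin_30 field_simps)
qed

lemma ln_tan_half_deriv:
  assumes "0 < t" "t < pi"
  shows "((\<lambda>t. ln (sin (t / 2)) - ln (cos (t / 2))) has_real_derivative (1 / sin t)) (at t)"
proof -
  have s: "sin (t / 2) > 0" and c: "cos (t / 2) > 0"
    using assms by (auto intro!: sin_gt_zero cos_gt_zero)
  have "sin t = 2 * sin (t / 2) * cos (t / 2)" using sin_double[of "t / 2"] by simp
  moreover have "((\<lambda>t. ln (sin (t / 2)) - ln (cos (t / 2))) has_real_derivative
      (cos (t / 2) * (1 / 2) / sin (t / 2) - (- sin (t / 2) * (1 / 2)) / cos (t / 2))) (at t)"
    using s c by (auto intro!: derivative_eq_intros)
  moreover have "cos (t / 2) * (1 / 2) / sin (t / 2) - (- sin (t / 2) * (1 / 2)) / cos (t / 2)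
    = ((sin (t / 2))\<^sup>2 + (cos (t / 2))\<^sup>2) / (2 * sin (t / 2) * cos (t / 2))"
    using s c by (simp add: field_simps power2_eq_square)
  ultimately show ?thesis by simp
qed

text \<open>
  Midpoint convexity of the cosecant, from the inequality between the arithmetic and the harmonic mean.
\<close>

lemma csc_midpoint:
  assumes "0 < x - \<delta>" "x + \<delta> < pi" "\<delta> \<ge> 0"
  shows "2 / sin x \<le> 1 / sin (x - \<delta>) + 1 / sin (x + \<delta>)"
proof -
  define a b where "a = sin (x - \<delta>)" and "b = sin (x + \<delta>)"
  have ab: "a > 0" "b > 0" and sx: "sin x > 0"
    unfolding a_def b_def using assms by (auto intro!: sin_gt_zero)
  have sum: "a + b = 2 * sin x * cos \<delta>" by (simp add: a_def b_def sin_add sin_diff)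
  then have "a + b \<le> 2 * sin x" using sx mult_left_mono[of "cos \<delta>" 1 "2 * sin x"] by simp
  have "4 / (2 * sin x) \<le> 4 / (a + b)"
    using \<open>a + b \<le> 2 * sin x\<close> ab sx by (intro divide_left_mono) auto
  also have "\<dots> \<le> 1 / a + 1 / b"
  proof -
    have "0 \<le> (a - b)\<^sup>2" by simp
    then show ?thesis using ab by (simp add: field_simps power2_eq_square)
  qed
  finally show ?thesis by (simp add: a_def b_def)
qed

text \<open>
  The Hermite-Hadamard inequality for the cosecant, with \<open>F\<close> any primitive of it: the midpoint rule underestimates.
\<close>

lemma csc_le_integral:
  fixes F :: "real \<Rightarrow> real"
  assumes F: "\<And>t. 0 < t \<Longrightarrow> t < pi \<Longrightarrow> (F has_real_derivative (1 / sin t)) (at t)"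
    and x: "0 < x - \<delta>" "x + \<delta> < pi" "\<delta> \<ge> 0"
  shows "2 * \<delta> / sin x \<le> F (x + \<delta>) - F (x - \<delta>)"
proof -
  define H where "H = (\<lambda>s. F (x + s) - F (x - s) - 2 * s / sin x)"
  have "H 0 \<le> H \<delta>"
  proof (rule DERIV_nonneg_imp_nondecreasing[OF x(3)])
    fix s assume s: "0 \<le> s" "s \<le> \<delta>"
    have "((\<lambda>s. F (x + s)) has_real_derivative 1 / sin (x + s) * 1) (at s)"
      using x s by (intro DERIV_chain2[where f=F] F) (auto intro!: derivative_eq_intros)
    moreover have "((\<lambda>s. F (x - s)) has_real_derivative 1 / sin (x - s) * (-1)) (at s)"
      using x s by (intro DERIV_chain2[where f=F] F) (auto intro!: derivative_eq_intros)
    moreover have "((\<lambda>s. 2 * s / sin x) has_real_derivative 2 / sin x) (at s)"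
      by (rule DERIV_cdivide) (auto intro!: derivative_eq_intros)
    ultimately have "(H has_real_derivative 1 / sin (x + s) * 1 - 1 / sin (x - s) * (-1) - 2 / sin x) (at s)"
      unfolding H_def by (intro DERIV_diff)
    moreover have "1 / sin (x + s) * 1 - 1 / sin (x - s) * (-1) - 2 / sin x \<ge> 0"
      using csc_midpoint[of x s] x s by simp
    ultimately show "\<exists>y. (H has_real_derivative y) (at s) \<and> 0 \<le> y" by blast
  qed
  then show ?thesis by (simp add: H_def)
qed

lemma le_tan:
  fixes y :: real
  assumes "0 \<le> y" "y < pi / 2"
  shows "y \<le> tan y"
proof -
  have "(\<lambda>z. sin z - z * cos z) 0 \<le> (\<lambda>z. sin z - z * cos z) y"
  proof (rule DERIV_nonneg_imp_nondecreasing[OF assms(1)])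
    fix z assume z: "0 \<le> z" "z \<le> y"
    have "((\<lambda>z. sin z - z * cos z) has_real_derivative z * sin z) (at z)"
      by (auto intro!: derivative_eq_intros)
    moreover have "z * sin z \<ge> 0" using z assms by (intro mult_nonneg_nonneg sin_ge_zero) auto
    ultimately show "\<exists>d. ((\<lambda>z. sin z - z * cos z) has_real_derivative d) (at z) \<and> 0 \<le> d" by blast
  qed
  moreover have "cos y > 0" using assms by (intro cos_gt_zero_pi) auto
  ultimately show ?thesis by (simp add: tan_def pos_le_divide_eq)
qed

text \<open>
  The terms with \<open>j \<ge> 1\<close> are values of the cosecant at the midpoints of a partition of \<open>{\<pi>/p..\<pi> P/p}\<close> into
  intervals of length \<open>\<pi>/p\<close>, hence are bounded by an integral.  The term \<open>j = 0\<close> is next to the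
  pole and is estimated separately, with equality for \<open>p = 3\<close>.
\<close>

lemma csc_sum_bound:
  assumes "p = 2 * P + 1" "P \<ge> 1"
  shows "(\<Sum>j<P. 1 / sin (pi * (2 * real j + 1) / (2 * real p))) \<le> 4 * real p / pi\<^sup>2 * ln (3 * real p)"
proof -
  define F where "F = (\<lambda>t::real. ln (sin (t / 2)) - ln (cos (t / 2)))"
  have p3: "real p \<ge> 3" using assms by simp
  have step: "1 / sin (pi * (2 * real j + 1) / (2 * real p)) \<le> real p / pi * (F (pi * real (Suc j) / real p) - F (pi * real j / real p))"
    if j: "1 \<le> j" "j < P" for j
  proof -
    define x \<delta> where "x = pi * (2 * real j + 1) / (2 * real p)" and "\<delta> = pi / (2 * real p)"
    have xd: "x - \<delta> = pi * real j / real p" "x + \<delta> = pi * real (Suc j) / real p"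
      using p3 by (simp_all add: x_def \<delta>_def field_simps)
    have "real (Suc j) < real p" using j assms by simp
    then have "pi * real (Suc j) / real p < pi"
      using p3 mult_strict_left_mono[of "real (Suc j)" "real p" pi] by (simp add: divide_less_eq)
    then have "x + \<delta> < pi" unfolding xd(2) .
    moreover have "0 < x - \<delta>" unfolding xd(1) using j p3 by simp
    moreover have "\<delta> \<ge> 0" by (simp add: \<delta>_def)
    ultimately have "2 * \<delta> / sin x \<le> F (x + \<delta>) - F (x - \<delta>)"
      unfolding F_def by (intro csc_le_integral ln_tan_half_deriv)
    then have "real p / pi * (2 * \<delta> / sin x) \<le> real p / pi * (F (x + \<delta>) - F (x - \<delta>))"
      by (intro mult_left_mono) auto
    moreover have "real p / pi * (2 * \<delta> / sin x) = 1 / sin x" using p3 by (simp add: \<delta>_def)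
    ultimately have "1 / sin x \<le> real p / pi * (F (x + \<delta>) - F (x - \<delta>))" by (simp only:)
    then show ?thesis unfolding xd unfolding x_def .
  qed
  have FP: "F (pi * real P / real p) \<le> 0"
  proof -
    define t where "t = pi * real P / real p"
    have t: "0 \<le> t / 2" "t / 2 < pi / 4" using assms by (auto simp: t_def field_simps)
    have "sin (t / 2) = cos (pi / 2 - t / 2)" by (simp add: cos_diff)
    also have "\<dots> \<le> cos (t / 2)" using t by (intro cos_monotone_0_pi_le) auto
    finally have "sin (t / 2) \<le> cos (t / 2)" .
    moreover have "0 < t / 2" using assms by (simp add: t_def)
    then have "sin (t / 2) > 0" using t pi_gt_zero by (intro sin_gt_zero) linarith+
    ultimately show ?thesis by (simp add: F_def flip: t_def)
  qed
  have F1: "- F (pi * 1 / real p) \<le> ln (2 * real p / pi)"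
  proof -
    define y where "y = pi / (2 * real p)"
    have y: "0 < y" "y < pi / 2" using p3 by (auto simp: y_def field_simps)
    have s: "sin y > 0" "cos y > 0" using y by (auto intro!: sin_gt_zero cos_gt_zero)
    have "y \<le> tan y" using y by (intro le_tan) auto
    then have "ln y \<le> ln (tan y)" using y(1) by (intro ln_mono)
    moreover have "ln (tan y) = F (pi * 1 / real p)"
    proof -
      have "pi * 1 / real p = 2 * y" by (simp add: y_def)
      then show ?thesis unfolding F_def tan_def using s by (simp only: ln_div) simp
    qed
    moreover have "- ln y = ln (2 * real p / pi)"
    proof -
      have "2 * real p / pi = inverse y" by (simp add: y_def)
      then show ?thesis using y(1) by (simp add: ln_inverse)
    qed
    ultimately show ?thesis by linarith
  qed
  have first: "1 / sin (pi * (2 * real 0 + 1) / (2 * real p)) \<le> 2 * real p / 3"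
  proof -
    have "sin (pi / (2 * real p)) \<ge> 3 / pi * (pi / (2 * real p))"
      using p3 by (intro sin_ge_on_0_pi_6) (auto simp: field_simps)
    then have "sin (pi / (2 * real p)) \<ge> 3 / (2 * real p)" by simp
    then have "1 / sin (pi / (2 * real p)) \<le> 1 / (3 / (2 * real p))" using p3 by (intro frac_le) auto
    then show ?thesis by simp
  qed
  have "{..<P} = insert 0 {1..<P}" using assms(2) by auto
  then have "(\<Sum>j<P. 1 / sin (pi * (2 * real j + 1) / (2 * real p)))
      = 1 / sin (pi * (2 * real 0 + 1) / (2 * real p)) + (\<Sum>j\<in>{1..<P}. 1 / sin (pi * (2 * real j + 1) / (2 * real p)))"
    by simp
  also have "(\<Sum>j\<in>{1..<P}. 1 / sin (pi * (2 * real j + 1) / (2 * real p)))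
      \<le> (\<Sum>j\<in>{1..<P}. real p / pi * (F (pi * real (Suc j) / real p) - F (pi * real j / real p)))"
    by (intro sum_mono step) auto
  also have "\<dots> = real p / pi * (F (pi * real P / real p) - F (pi * real 1 / real p))"
    using sum_Suc_diff'[OF assms(2), of "\<lambda>j. F (pi * real j / real p)"] by (simp only: flip: sum_distrib_left)
  also have "\<dots> \<le> real p / pi * ln (2 * real p / pi)"
    using FP F1 by (intro mult_left_mono) auto
  finally have "(\<Sum>j<P. 1 / sin (pi * (2 * real j + 1) / (2 * real p)))
      \<le> 2 * real p / 3 + real p / pi * ln (2 * real p / pi)" using first by simp
  also have "\<dots> = real p * (2/3 + ln (2 * real p / pi) / pi)" by (simp add: algebra_simps)
  also have "\<dots> \<le> real p * (4 / pi\<^sup>2 * ln (3 * real p))"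
    using log_comparison[OF p3] by (intro mult_left_mono) auto
  finally show ?thesis by (simp add: algebra_simps)
qed

section \<open>From complete sums to the counting function\<close>

text \<open>
  The additive character \<open>k \<mapsto> exp (2 \<pi> i k / p)\<close> of the integers modulo \<open>p\<close>.
\<close>

definition unit_root :: "nat \<Rightarrow> int \<Rightarrow> complex" where
  "unit_root p k = cis (2 * pi * real_of_int k / real p)"

lemma unit_root_add: "unit_root p (a + b) = unit_root p a * unit_root p b"
  by (simp add: unit_root_def cis_mult add_divide_distrib ring_distribs)

lemma unit_root_0 [simp]: "unit_root p 0 = 1"
  by (simp add: unit_root_def)

lemma norm_unit_root [simp]: "cmod (unit_root p k) = 1"
  by (simp add: unit_root_def)

lemma unit_root_mult: "unit_root p (int n * k) = unit_root p k ^ n"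
  by (induction n) (simp_all add: unit_root_add algebra_simps)

lemma unit_root_cong: "[a = b] (mod int p) \<Longrightarrow> p > 0 \<Longrightarrow> unit_root p a = unit_root p b"
  unfolding unit_root_def by (rule cis_eq_if_cong)

lemma unit_root_eq_1_iff:
  assumes "p > 0" shows "unit_root p k = 1 \<longleftrightarrow> int p dvd k"
proof
  assume "unit_root p k = 1"
  then have "cos (2 * pi * real_of_int k / real p) = 1"
    unfolding unit_root_def by (metis cis.sel(1) one_complex.sel(1))
  then obtain n :: int where "2 * pi * real_of_int k / real p = real_of_int n * 2 * pi"
    unfolding cos_one_2pi_int by blast
  then have "2 * pi * real_of_int k = 2 * pi * (real p * real_of_int n)"
    using assms by (simp add: divide_eq_eq mult_ac)
  then have "real_of_int k = real_of_int (int p * n)" by (simp only: mult_cancel_left) simp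
  then show "int p dvd k" by (simp only: of_int_eq_iff) simp
next
  assume "int p dvd k"
  then have "[k = 0] (mod int p)" by (simp add: cong_0_iff)
  then show "unit_root p k = 1" using unit_root_cong[of k 0 p] assms by simp
qed

lemma unit_root_orthogonality:
  assumes "p > 0"
  shows "(\<Sum>h<p. unit_root p (int h * t)) = (if int p dvd t then of_nat p else 0)"
proof (cases "int p dvd t")
  case True
  then have "unit_root p (int h * t) = 1" for h using assms by (simp add: unit_root_eq_1_iff)
  with True show ?thesis by simp
next
  case False
  then have z: "unit_root p t \<noteq> 1" using assms by (simp add: unit_root_eq_1_iff)
  have "(\<Sum>h<p. unit_root p (int h * t)) = (\<Sum>h<p. unit_root p t ^ h)" by (simp add: unit_root_mult)
  also have "\<dots> = (unit_root p t ^ p - 1) / (unit_root p t - 1)" using z by (rule geometric_sum)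
  also have "unit_root p t ^ p = 1" using assms by (simp add: unit_root_eq_1_iff flip: unit_root_mult)
  finally show ?thesis using False by simp
qed

lemma norm_one_minus_cis: "cmod (1 - cis t) = 2 * \<bar>sin (t / 2)\<bar>"
proof -
  have "(cmod (1 - cis t))\<^sup>2 = (1 - cos t)\<^sup>2 + (sin t)\<^sup>2"
    by (simp add: cmod_power2)
  also have "\<dots> = 2 - 2 * cos t"
    using sin_cos_squared_add[of t] by (simp add: power2_eq_square algebra_simps)
  also have "\<dots> = (2 * \<bar>sin (t / 2)\<bar>)\<^sup>2"
    using cos_double_sin[of "t / 2"] by (simp add: power_mult_distrib)
  finally show ?thesis by (rule power2_eq_imp_eq) auto
qed

lemma abs_sin_add_npi: "\<bar>sin (x + real i * pi)\<bar> = \<bar>sin x\<bar>"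
  by (simp add: sin_add abs_mult)

text \<open>
  The geometric sum has modulus \<open>|sin (\<pi> h P / p)| / sin (\<pi> h / p)\<close>.  Since \<open>P / p\<close> is close to \<open>1/2\<close>,
  the numerator is \<open>sin \<alpha>\<close> or \<open>cos \<alpha>\<close> with \<open>\<alpha> = \<pi> h / (2 p)\<close>, according to the parity of \<open>h\<close>, and
  it cancels one factor of \<open>sin (2 \<alpha>) = 2 sin \<alpha> cos \<alpha>\<close>.
\<close>

lemma norm_upper_half_sum_le:
  assumes p: "p = 2 * P + 1" and h: "1 \<le> h" "h < p"
  shows "cmod (\<Sum>u\<in>{P+1..<p}. unit_root p (- (int h * int u)))
    \<le> 1 / (2 * sin (pi * real (if odd h then h else p - h) / (2 * real p)))"
proof -
  define \<alpha> where "\<alpha> = pi * real h / (2 * real p)"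
  define z where "z = unit_root p (- int h)"
  have p0: "real p > 0" using p by simp
  have al: "0 < \<alpha>" "\<alpha> < pi / 2" using h p0 by (auto simp: \<alpha>_def field_simps)
  have sc: "sin \<alpha> > 0" "cos \<alpha> > 0" using al by (auto intro!: sin_gt_zero cos_gt_zero)
  have zn: "z ^ n = cis (- (2 * pi * real h * real n / real p))" for n
    unfolding z_def unit_root_mult[symmetric] by (simp add: unit_root_def mult_ac)
  have n1: "cmod (1 - z) = 2 * (2 * sin \<alpha> * cos \<alpha>)"
  proof -
    have "cmod (1 - z) = 2 * \<bar>sin (2 * \<alpha>)\<bar>"
      using zn[of 1] norm_one_minus_cis[of "- (2 * pi * real h / real p)"] by (simp add: \<alpha>_def)
    then show ?thesis using sc by (simp add: sin_double abs_mult)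
  qed
  have angle: "pi * real h * real P / real p = pi * real h / 2 - \<alpha>"
    using p0 by (simp add: \<alpha>_def field_simps p)
  have nP: "cmod (1 - z ^ P) = 2 * \<bar>sin (pi * real h / 2 - \<alpha>)\<bar>"
    using zn[of P] norm_one_minus_cis[of "- (2 * pi * real h * real P / real p)"] by (simp add: mult.assoc flip: angle)
  have "(\<Sum>u\<in>{P+1..<p}. unit_root p (- (int h * int u))) = (\<Sum>i<P. z ^ (P + 1) * z ^ i)"
  proof (rule sum.reindex_bij_witness[of _ "\<lambda>i. P + 1 + i" "\<lambda>u. u - (P + 1)"])
    fix u assume "u \<in> {P + 1..<p}"
    then have "P + 1 + (u - (P + 1)) = u" by simp
    then have "z ^ (P + 1) * z ^ (u - (P + 1)) = z ^ u" by (metis power_add)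
    also have "\<dots> = unit_root p (- (int h * int u))" by (simp add: z_def mult.commute flip: unit_root_mult)
    finally show "z ^ (P + 1) * z ^ (u - (P + 1)) = unit_root p (- (int h * int u))" .
  qed (use p in auto)
  also have "\<dots> = z ^ (P + 1) * (\<Sum>i<P. z ^ i)" by (simp add: sum_distrib_left)
  finally have "cmod (\<Sum>u\<in>{P+1..<p}. unit_root p (- (int h * int u))) = cmod (\<Sum>i<P. z ^ i)"
    by (simp add: norm_mult norm_power z_def)
  moreover have "cmod (1 - z) * cmod (\<Sum>i<P. z ^ i) = cmod (1 - z ^ P)"
    unfolding norm_mult[symmetric] by (simp add: one_diff_power_eq)
  ultimately have eq: "cmod (\<Sum>u\<in>{P+1..<p}. unit_root p (- (int h * int u)))
      = \<bar>sin (pi * real h / 2 - \<alpha>)\<bar> / (2 * sin \<alpha> * cos \<alpha>)"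
    unfolding n1 nP using sc by (simp add: field_simps)
  show ?thesis
  proof (cases "odd h")
    case True
    then obtain i where "h = 2 * i + 1" by (auto elim: oddE)
    then have "pi * real h / 2 - \<alpha> = pi / 2 - \<alpha> + real i * pi" by (simp add: algebra_simps add_divide_distrib)
    then have "\<bar>sin (pi * real h / 2 - \<alpha>)\<bar> = \<bar>sin (pi / 2 - \<alpha>)\<bar>" by (simp only: abs_sin_add_npi)
    then have "\<bar>sin (pi * real h / 2 - \<alpha>)\<bar> = cos \<alpha>" using sc by (simp add: sin_diff)
    then show ?thesis using sc True unfolding eq by (simp add: \<alpha>_def)
  next
    case False
    then obtain i where "h = 2 * i" by (auto elim: evenE)
    then have "pi * real h / 2 - \<alpha> = - \<alpha> + real i * pi" by simp
    then have "\<bar>sin (pi * real h / 2 - \<alpha>)\<bar> = \<bar>sin (- \<alpha>)\<bar>" by (simp only: abs_sin_add_npi)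
    then have "\<bar>sin (pi * real h / 2 - \<alpha>)\<bar> = sin \<alpha>" using sc by simp
    moreover have "pi * real (p - h) / (2 * real p) = pi / 2 - \<alpha>"
      using h p0 by (simp add: \<alpha>_def of_nat_diff field_simps)
    ultimately show ?thesis using sc False unfolding eq by (simp add: sin_diff)
  qed
qed

text \<open>
  As \<open>p\<close> is odd, \<open>h \<mapsto> p - h\<close> exchanges the even and the odd \<open>h\<close>.
\<close>

lemma sum_odd_reflected:
  fixes w :: "nat \<Rightarrow> real"
  assumes p: "p = 2 * P + 1"
  shows "(\<Sum>h\<in>{1..<p}. w (if odd h then h else p - h)) = 2 * (\<Sum>j<P. w (2 * j + 1))"
proof -
  have split: "{1..<p} = {h\<in>{1..<p}. odd h} \<union> {h\<in>{1..<p}. even h}" by auto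
  have "(\<Sum>h\<in>{1..<p}. w (if odd h then h else p - h))
      = (\<Sum>h\<in>{h\<in>{1..<p}. odd h}. w h) + (\<Sum>h\<in>{h\<in>{1..<p}. even h}. w (p - h))"
    by (subst split, subst sum.union_disjoint) auto
  also have "(\<Sum>h\<in>{h\<in>{1..<p}. odd h}. w h) = (\<Sum>j<P. w (2 * j + 1))"
    by (rule sum.reindex_bij_witness[of _ "\<lambda>j. 2 * j + 1" "\<lambda>h. h div 2"]) (auto simp: p elim!: oddE)
  also have "(\<Sum>h\<in>{h\<in>{1..<p}. even h}. w (p - h)) = (\<Sum>j<P. w (2 * j + 1))"
    by (rule sum.reindex_bij_witness[of _ "\<lambda>j. p - (2 * j + 1)" "\<lambda>h. (p - h) div 2"])
       (auto simp: p Suc_diff_le elim!: evenE)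
  finally show ?thesis by simp
qed

text \<open>
  Reflection turns the half sum into a sum over \<open>{c-P..c-1}\<close>, and moving a window of
  \<open>P\<close> consecutive integers by one changes the sum by at most 2.  After a move by \<open>c\<close>, the two
  half sums and the term at 0 form a complete sum.
\<close>

lemma symmetric_half_sum:
  fixes g :: "int \<Rightarrow> complex"
  assumes p: "p = 2 * P + 1" and per: "\<And>k. g (k + int p) = g k" and sym: "\<And>k. g (c - k) = g k"
    and bd: "\<And>k. cmod (g k) \<le> 1"
  shows "2 * cmod (\<Sum>k\<in>{1..int P}. g k) \<le> cmod (\<Sum>j<p. g (int j)) + 2 * \<bar>real_of_int c\<bar> + 1"
proof -
  define A where "A = (\<lambda>a. \<Sum>k\<in>{a..<a + int P}. g k)"
  have A1: "cmod (A (a + 1) - A a) \<le> 2" for a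
  proof -
    have "g a + A (a + 1) = (\<Sum>k\<in>insert a {a + 1..<a + 1 + int P}. g k)" by (simp add: A_def)
    also have "insert a {a + 1..<a + 1 + int P} = insert (a + int P) {a..<a + int P}" by auto
    also have "(\<Sum>k\<in>\<dots>. g k) = g (a + int P) + A a" by (simp add: A_def)
    finally have "A (a + 1) - A a = g (a + int P) - g a" by (simp add: algebra_simps)
    then show ?thesis using norm_triangle_ineq4[of "g (a + int P)" "g a"] bd[of "a + int P"] bd[of a] by simp
  qed
  have A2: "cmod (A (a + int n) - A a) \<le> 2 * real n" for a n
  proof (induction n)
    case (Suc n)
    have "A (a + int (Suc n)) - A a = (A (a + int n + 1) - A (a + int n)) + (A (a + int n) - A a)"
      by (simp add: algebra_simps)
    then show ?case using Suc A1[of "a + int n"]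
      norm_triangle_ineq[of "A (a + int n + 1) - A (a + int n)" "A (a + int n) - A a"] by simp
  qed simp
  have A3: "cmod (A (c - int P) - A (- int P)) \<le> 2 * \<bar>real_of_int c\<bar>"
  proof (cases "c \<ge> 0")
    case True then show ?thesis using A2[of "- int P" "nat c"] by simp
  next
    case False then show ?thesis using A2[of "c - int P" "nat (- c)"] by (simp add: norm_minus_commute)
  qed
  have S: "(\<Sum>k\<in>{1..int P}. g k) = A 1" unfolding A_def by (rule sum.cong) auto
  have S': "(\<Sum>k\<in>{1..int P}. g k) = A (c - int P)" unfolding A_def
    by (rule sum.reindex_bij_witness[of _ "\<lambda>k. c - k" "\<lambda>k. c - k"]) (auto simp: sym)
  have "(\<Sum>j<p. g (int j)) = (\<Sum>k\<in>{0..<int p}. g k)"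
    by (rule sum.reindex_bij_witness[of _ nat int]) auto
  also have "{0..<int p} = insert 0 {1..<1 + int P} \<union> {int P + 1..<int P + 1 + int P}" using p by auto
  also have "(\<Sum>k\<in>\<dots>. g k) = g 0 + A 1 + A (int P + 1)"
    by (subst sum.union_disjoint) (auto simp: A_def)
  also have "A (int P + 1) = A (- int P)" unfolding A_def
  proof (rule sum.reindex_bij_witness[of _ "\<lambda>k. k + int p" "\<lambda>k. k - int p"])
    fix k show "g (k - int p) = g k" using per[of "k - int p"] by simp
  qed (auto simp: p)
  finally have "2 * (\<Sum>k\<in>{1..int P}. g k) = (\<Sum>j<p. g (int j)) - g 0 + (A (c - int P) - A (- int P))"
    using S S' by (simp add: algebra_simps)
  then have "cmod (2 * (\<Sum>k\<in>{1..int P}. g k)) \<le> cmod (\<Sum>j<p. g (int j)) + cmod (g 0) + cmod (A (c - int P) - A (- int P))"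
    by (metis norm_triangle_ineq norm_triangle_ineq4 add_right_mono order_trans)
  then show ?thesis using A3 bd[of 0] by (simp add: norm_mult)
qed

lemma f_count_altdef:
  assumes p: "p = 2 * P + 1"
  shows "f_count \<phi> p = card {k\<in>{1..int P}. poly \<phi> k mod int p > int P}"
proof -
  have p0: "real p > 0" using p by simp
  have "1 \<le> k \<and> real_of_int k < real p / 2 \<and> frac (real_of_int (poly \<phi> k) / real p) > 1 / 2
    \<longleftrightarrow> k \<in> {1..int P} \<and> poly \<phi> k mod int p > int P" for k
  proof -
    have fr: "frac (real_of_int (poly \<phi> k) / real p) = real_of_int (poly \<phi> k mod int p) / real p"
    proof -
      have "real_of_int (poly \<phi> k) = real_of_int (int p * (poly \<phi> k div int p) + poly \<phi> k mod int p)" by simp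
      also have "\<dots> = real p * real_of_int (poly \<phi> k div int p) + real_of_int (poly \<phi> k mod int p)"
        by (simp only: of_int_add of_int_mult of_int_of_nat_eq)
      finally have "real_of_int (poly \<phi> k) / real p = real_of_int (poly \<phi> k div int p) + real_of_int (poly \<phi> k mod int p) / real p"
        using p0 by (simp add: add_divide_distrib)
      then show ?thesis
        using floor_divide_of_int_eq[of "poly \<phi> k" "int p", where 'a=real] by (simp add: frac_def)
    qed
    have "frac (real_of_int (poly \<phi> k) / real p) > 1 / 2 \<longleftrightarrow> real_of_int (2 * (poly \<phi> k mod int p)) > real_of_int (int p)"
      unfolding fr using p0 by (simp add: field_simps)
    also have "\<dots> \<longleftrightarrow> poly \<phi> k mod int p > int P" unfolding of_int_less_iff using p by linarith
    finally have 1: "frac (real_of_int (poly \<phi> k) / real p) > 1 / 2 \<longleftrightarrow> poly \<phi> k mod int p > int P" .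
    have "real_of_int k < real p / 2 \<longleftrightarrow> real_of_int (2 * k) < real_of_int (int p)" by (simp add: field_simps)
    also have "\<dots> \<longleftrightarrow> k \<le> int P" unfolding of_int_less_iff using p by linarith
    finally show ?thesis using 1 by auto
  qed
  then show ?thesis unfolding f_count_def by (intro arg_cong[of _ _ card]) auto
qed

text \<open>
  Orthogonality detects the equality of \<open>\<phi> k\<close> with each residue \<open>u\<close> of the upper half.
\<close>

lemma f_count_fourier:
  assumes p: "p = 2 * P + 1"
  shows "of_nat (p * f_count \<phi> p) = (\<Sum>h<p. (\<Sum>u\<in>{P+1..<p}. unit_root p (- (int h * int u))) *
      (\<Sum>k\<in>{1..int P}. unit_root p (int h * poly \<phi> k)))"
proof -
  have p0: "p > 0" using p by simp
  have single: "(\<Sum>u\<in>{P+1..<p}. if int p dvd poly \<phi> k - int u then of_nat p else 0)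
      = (if poly \<phi> k mod int p > int P then of_nat p else (0::complex))" for k
  proof -
    define v where "v = nat (poly \<phi> k mod int p)"
    have v: "int v = poly \<phi> k mod int p" "v < p" using p0 by (auto simp: v_def nat_less_iff)
    have "int p dvd poly \<phi> k - int u \<longleftrightarrow> u = v" if "u \<in> {P+1..<p}" for u
    proof -
      have "int p dvd poly \<phi> k - int u \<longleftrightarrow> poly \<phi> k mod int p = int u mod int p"
        by (simp add: mod_eq_dvd_iff)
      also have "\<dots> \<longleftrightarrow> u = v" unfolding v(1)[symmetric] using that by auto
      finally show ?thesis .
    qed
    then have "(\<Sum>u\<in>{P+1..<p}. if int p dvd poly \<phi> k - int u then of_nat p else 0)
        = (\<Sum>u\<in>{P+1..<p}. if u = v then of_nat p else (0::complex))" by (intro sum.cong) auto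
    also have "\<dots> = (if poly \<phi> k mod int p > int P then of_nat p else 0)"
      unfolding v(1)[symmetric] using v(2) by auto
    finally show ?thesis .
  qed
  have "(\<Sum>h<p. (\<Sum>u\<in>{P+1..<p}. unit_root p (- (int h * int u))) * (\<Sum>k\<in>{1..int P}. unit_root p (int h * poly \<phi> k)))
      = (\<Sum>h<p. \<Sum>k\<in>{1..int P}. \<Sum>u\<in>{P+1..<p}. unit_root p (int h * (poly \<phi> k - int u)))"
  proof (intro sum.cong refl)
    fix h
    have "unit_root p (- (int h * int u)) * unit_root p (int h * poly \<phi> k) = unit_root p (int h * (poly \<phi> k - int u))" for u k
      unfolding unit_root_add[symmetric] by (simp add: algebra_simps)
    then show "(\<Sum>u\<in>{P+1..<p}. unit_root p (- (int h * int u))) * (\<Sum>k\<in>{1..int P}. unit_root p (int h * poly \<phi> k))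
      = (\<Sum>k\<in>{1..int P}. \<Sum>u\<in>{P+1..<p}. unit_root p (int h * (poly \<phi> k - int u)))"
      unfolding sum_product by (simp only:) (rule sum.swap)
  qed
  also have "\<dots> = (\<Sum>k\<in>{1..int P}. \<Sum>u\<in>{P+1..<p}. \<Sum>h<p. unit_root p (int h * (poly \<phi> k - int u)))"
    by (subst sum.swap) (intro sum.cong refl sum.swap)
  also have "\<dots> = (\<Sum>k\<in>{1..int P}. if poly \<phi> k mod int p > int P then of_nat p else 0)"
    by (simp only: unit_root_orthogonality[OF p0] single)
  also have "\<dots> = of_nat (p * f_count \<phi> p)"
    unfolding f_count_altdef[OF p] by (simp flip: sum.inter_filter)
  finally show ?thesis by simp
qed

lemma degree_reduce_mod_le: "degree (reduce_mod p \<phi>) \<le> degree \<phi>"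
  unfolding reduce_mod_def by (rule degree_map_poly_le)

text \<open>
  If \<open>m \<ge> p\<close>, the right-hand side exceeds the trivial bound \<open>p\<close>; otherwise the
  reduced degree is less than \<open>p\<close>, hence prime to it.
\<close>

lemma weil_bound_all_degrees:
  assumes p: "prime p" "odd p" and d: "degree (reduce_mod p \<phi>) > 0" and m: "degree \<phi> \<le> m"
    and h: "1 \<le> h" "h < p"
  shows "cmod (\<Sum>j<p. unit_root p (int h * poly \<phi> (int j))) \<le> (real m - 1) * sqrt (real p)"
proof (cases "real p \<le> (real m - 1) * sqrt (real p)")
  case True
  have "cmod (\<Sum>j<p. unit_root p (int h * poly \<phi> (int j))) \<le> (\<Sum>j<p. cmod (unit_root p (int h * poly \<phi> (int j))))"
    by (rule norm_sum)
  then show ?thesis using True by simp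
next
  case False
  have p3: "p \<ge> 3" using p prime_ge_2_nat[of p] by (cases "p = 2") auto
  have "coeff (reduce_mod p (smult (int h) \<phi>)) i = 0 \<longleftrightarrow> coeff (reduce_mod p \<phi>) i = 0" for i
  proof -
    have "\<not> int p dvd int h" using h by (auto dest: nat_dvd_not_less simp: int_dvd_int_iff)
    then have "int p dvd int h * coeff \<phi> i \<longleftrightarrow> int p dvd coeff \<phi> i"
      using p(1) by (simp add: prime_dvd_mult_iff)
    then show ?thesis by (simp add: coeff_reduce_mod dvd_eq_mod_eq_0)
  qed
  then have deg: "degree (reduce_mod p (smult (int h) \<phi>)) = degree (reduce_mod p \<phi>)"
    by (simp add: degree_def)
  have dm: "degree (reduce_mod p \<phi>) \<le> m" using degree_reduce_mod_le[of p \<phi>] m by simp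
  have "m < p"
  proof (rule ccontr)
    assume "\<not> m < p"
    have "real p * 1 \<le> (real p - 1) * sqrt (real p)"
    proof -
      have "sqrt (real p) \<ge> 3 / 2" using p3 by (intro real_le_rsqrt) (simp add: power2_eq_square)
      then have "(real p - 1) * (3 / 2) \<le> (real p - 1) * sqrt (real p)" using p3 by (intro mult_left_mono) auto
      then show ?thesis using p3 by simp
    qed
    moreover have "(real p - 1) * sqrt (real p) \<le> (real m - 1) * sqrt (real p)"
      using \<open>\<not> m < p\<close> by (intro mult_right_mono) auto
    ultimately show False using False by simp
  qed
  then have "1 \<le> degree (reduce_mod p (smult (int h) \<phi>)) \<and> degree (reduce_mod p (smult (int h) \<phi>)) < p"
    using d dm deg by simp
  from weil_bound_prime[OF p(1), unfolded satisfies_weil_def, rule_format, OF this]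
  have "cmod (\<Sum>j<p. cis (2 * pi * real_of_int (poly (smult (int h) \<phi>) (int j)) / real p))
    \<le> (real (degree (reduce_mod p \<phi>)) - 1) * sqrt (real p)"
    unfolding deg .
  also have "\<dots> \<le> (real m - 1) * sqrt (real p)" using dm by (intro mult_right_mono) auto
  finally show ?thesis by (simp add: unit_root_def)
qed

lemma poly_cong:
  fixes \<phi> :: "int poly"
  assumes "[a = b] (mod q)" shows "[poly \<phi> a = poly \<phi> b] (mod q)"
  using assms by (induction \<phi>) (auto intro!: cong_add cong_mult)

lemma f_count_bound:
  assumes p: "prime p" "odd p" and d: "degree (reduce_mod p \<phi>) > 0" and m: "degree \<phi> \<le> m"
    and sym: "pcompose \<phi> [:c, -1:] = \<phi>"
  shows "\<bar>real (f_count \<phi> p) - (real p - 1)^2 / (4 * real p)\<bar>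
              \<le> 2 / pi^2 * ((real m - 1) * sqrt (real p) + 2 * real_of_int \<bar>c\<bar> + 3)
                  * ln (3 * real p)"
proof -
  obtain P where P: "p = 2 * P + 1" using p(2) by (auto elim: oddE)
  have "p > 1" using p(1) by (rule prime_gt_1_nat)
  then have P1: "P \<ge> 1" and p0: "p > 0" using P by auto
  define B where "B = (real m - 1) * sqrt (real p) + 2 * real_of_int \<bar>c\<bar> + 3"
  define T where "T = (\<lambda>h. \<Sum>u\<in>{P+1..<p}. unit_root p (- (int h * int u)))"
  define S where "S = (\<lambda>h. \<Sum>k\<in>{1..int P}. unit_root p (int h * poly \<phi> k))"
  define w where "w = (\<lambda>h. 1 / (2 * sin (pi * real h / (2 * real p))))"
  have sym': "poly \<phi> (c - k) = poly \<phi> k" for k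
  proof -
    have "poly \<phi> k = poly (pcompose \<phi> [:c, -1:]) k" unfolding sym ..
    then show ?thesis by (simp add: poly_pcompose)
  qed
  have S: "cmod (S h) \<le> B / 2" if h: "1 \<le> h" "h < p" for h
  proof -
    have "2 * cmod (S h) \<le> cmod (\<Sum>j<p. unit_root p (int h * poly \<phi> (int j))) + 2 * \<bar>real_of_int c\<bar> + 1"
      unfolding S_def
    proof (rule symmetric_half_sum[OF P])
      fix k
      have "[poly \<phi> (k + int p) = poly \<phi> k] (mod int p)"
        by (rule poly_cong) (simp add: Cong.cong_def)
      then show "unit_root p (int h * poly \<phi> (k + int p)) = unit_root p (int h * poly \<phi> k)"
        using p0 by (intro unit_root_cong cong_scalar_left)
    qed (auto simp: sym')
    then show ?thesis using weil_bound_all_degrees[OF p d m h] by (simp add: B_def)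
  qed
  have T: "cmod (T h) \<le> w (if odd h then h else p - h)" if "h \<in> {1..<p}" for h
    using norm_upper_half_sum_le[OF P, of h] that by (simp add: T_def w_def)
  have B0: "B \<ge> 0" using S[of 1] norm_ge_zero[of "S 1"] \<open>p > 1\<close> by linarith
  have fourier: "of_nat (p * f_count \<phi> p) = of_nat (P * P) + (\<Sum>h\<in>{1..<p}. T h * S h)"
  proof -
    have "of_nat (p * f_count \<phi> p) = (\<Sum>h<p. T h * S h)"
      using f_count_fourier[OF P, of \<phi>] by (simp add: T_def S_def)
    also have "{..<p} = insert 0 {1..<p}" using p0 by auto
    also have "(\<Sum>h\<in>\<dots>. T h * S h) = T 0 * S 0 + (\<Sum>h\<in>{1..<p}. T h * S h)" by simp
    also have "T 0 * S 0 = of_nat (P * P)" by (simp add: T_def S_def P)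
    finally show ?thesis .
  qed
  have "of_real (real p * real (f_count \<phi> p) - real P * real P) = (\<Sum>h\<in>{1..<p}. T h * S h)"
    using fourier by simp
  then have "\<bar>real p * real (f_count \<phi> p) - real P * real P\<bar> = cmod (\<Sum>h\<in>{1..<p}. T h * S h)"
    using norm_of_real[of "real p * real (f_count \<phi> p) - real P * real P", where 'a=complex] by (simp only:)
  also have "\<dots> \<le> (\<Sum>h\<in>{1..<p}. cmod (T h * S h))" by (rule norm_sum)
  also have "\<dots> \<le> (\<Sum>h\<in>{1..<p}. w (if odd h then h else p - h) * (B / 2))"
    unfolding norm_mult
  proof (intro sum_mono mult_mono T S)
    fix h assume h: "h \<in> {1..<p}"
    then show "0 \<le> w (if odd h then h else p - h)" using order_trans[OF norm_ge_zero T[OF h]] by simp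
  qed auto
  also have "\<dots> = (\<Sum>h\<in>{1..<p}. w (if odd h then h else p - h)) * (B / 2)"
    by (rule sum_distrib_right[symmetric])
  also have "\<dots> = B / 2 * (2 * (\<Sum>j<P. w (2 * j + 1)))"
    unfolding sum_odd_reflected[OF P] by (rule mult.commute)
  also have "2 * (\<Sum>j<P. w (2 * j + 1)) = (\<Sum>j<P. 1 / sin (pi * (2 * real j + 1) / (2 * real p)))"
    by (simp add: sum_distrib_left w_def add.commute)
  also have "B / 2 * \<dots> \<le> B / 2 * (4 * real p / pi\<^sup>2 * ln (3 * real p))"
    using csc_sum_bound[OF P P1] B0 by (intro mult_left_mono) auto
  finally have main: "\<bar>real p * real (f_count \<phi> p) - real P * real P\<bar> \<le> real p * (2 / pi\<^sup>2 * B * ln (3 * real p))"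
    by (simp add: algebra_simps)
  have half: "real P = (real p - 1) / 2" using P by simp
  have "real p * (real (f_count \<phi> p) - (real p - 1)^2 / (4 * real p)) = real p * real (f_count \<phi> p) - real P * real P"
    unfolding half using p0 by (simp add: power2_eq_square field_simps)
  then have "real p * \<bar>real (f_count \<phi> p) - (real p - 1)^2 / (4 * real p)\<bar> = \<bar>real p * real (f_count \<phi> p) - real P * real P\<bar>"
    using abs_mult[of "real p"] by (metis abs_of_nat)
  then have "real p * \<bar>real (f_count \<phi> p) - (real p - 1)^2 / (4 * real p)\<bar> \<le> real p * (2 / pi\<^sup>2 * B * ln (3 * real p))"
    using main by (simp only:)
  then show ?thesis using p0 unfolding B_def by (simp only: mult_le_cancel_left_pos of_nat_0_less_iff)
qed

text \<open>
  The asymptotic statement needs the primes for which the reduction is constant as well.  These divide the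
  leading coefficient, so they are bounded in terms of \<open>\<phi>\<close>, and the trivial estimate \<open>f_count \<phi> p \<le> p\<close> suffices for them.
\<close>

theorem theorem1p4:
  fixes \<phi> :: "int poly" and m :: nat and c :: int
  assumes "degree \<phi> = m" and "m \<ge> 2"
    and "pcompose \<phi> [:c, -1:] = \<phi>"
  shows "(\<forall>p::nat. prime p \<and> odd p \<and> degree (reduce_mod p \<phi>) > 0 \<longrightarrow>
            \<bar>real (f_count \<phi> p) - (real p - 1)^2 / (4 * real p)\<bar>
              \<le> 2 / pi^2 * ((real m - 1) * sqrt (real p) + 2 * real_of_int \<bar>c\<bar> + 3)
                  * ln (3 * real p))
       \<and> (\<exists>C::real. C > 0 \<and> (\<forall>p::nat. prime p \<and> odd p \<longrightarrow>
            \<bar>real (f_count \<phi> p) - real p / 4\<bar> \<le> C * (sqrt (real p) * ln (real p))))"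
proof -
  have bound: "\<bar>real (f_count \<phi> p) - (real p - 1)^2 / (4 * real p)\<bar>
      \<le> 2 / pi^2 * ((real m - 1) * sqrt (real p) + 2 * real_of_int \<bar>c\<bar> + 3) * ln (3 * real p)"
    if "prime p" "odd p" "degree (reduce_mod p \<phi>) > 0" for p
    using that assms by (intro f_count_bound) auto
  define K where "K = real m + 2 + 2 * real_of_int \<bar>c\<bar>"
  define l where "l = real_of_int \<bar>lead_coeff \<phi>\<bar>"
  have "\<bar>real (f_count \<phi> p) - real p / 4\<bar> \<le> (1 + K + l) * (sqrt (real p) * ln (real p))"
    if p: "prime p" "odd p" for p
  proof -
    have p3: "p \<ge> 3" using p prime_ge_2_nat[of p] by (cases "p = 2") auto
    have s1: "sqrt (real p) \<ge> 1" using p3 by simp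
    have "exp 1 \<le> real p" using exp_le p3 by linarith
    then have l1: "ln (real p) \<ge> 1" using p3 by (subst ln_ge_iff) auto
    have sl: "sqrt (real p) * ln (real p) \<ge> 1" using mult_mono[OF s1 l1] by simp
    have K0: "K \<ge> 0" "l \<ge> 0" by (auto simp: K_def l_def)
    show ?thesis
    proof (cases "degree (reduce_mod p \<phi>) > 0")
      case True
      have "(real m - 1) * sqrt (real p) + 2 * real_of_int \<bar>c\<bar> + 3 \<le> K * sqrt (real p)"
      proof -
        have "(2 * real_of_int \<bar>c\<bar> + 3) * 1 \<le> (2 * real_of_int \<bar>c\<bar> + 3) * sqrt (real p)"
          using s1 by (intro mult_left_mono) auto
        then show ?thesis by (simp add: K_def algebra_simps)
      qed
      moreover have "ln (3 * real p) \<le> 2 * ln (real p)"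
        using p3 by (simp add: ln_mult)
      ultimately have "2 / pi^2 * ((real m - 1) * sqrt (real p) + 2 * real_of_int \<bar>c\<bar> + 3) * ln (3 * real p)
         \<le> 2 / pi^2 * (K * sqrt (real p)) * (2 * ln (real p))"
        using p3 K0 by (intro mult_mono mult_left_mono) (auto intro!: mult_nonneg_nonneg)
      also have "\<dots> = 4 / pi^2 * (K * (sqrt (real p) * ln (real p)))" by simp
      also have "\<dots> \<le> 1 * (K * (sqrt (real p) * ln (real p)))"
      proof (intro mult_right_mono mult_nonneg_nonneg)
        have "2\<^sup>2 \<le> pi\<^sup>2" using pi_ge_two by (intro power_mono) auto
        then show "4 / pi\<^sup>2 \<le> 1" by simp
      qed (use K0 l1 in auto)
      finally have "\<bar>real (f_count \<phi> p) - (real p - 1)^2 / (4 * real p)\<bar> \<le> K * (sqrt (real p) * ln (real p))"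
        using bound[OF p True] by linarith
      moreover have "\<bar>(real p - 1)^2 / (4 * real p) - real p / 4\<bar> \<le> 1"
      proof -
        have "(real p - 1)^2 / (4 * real p) - real p / 4 = 1 / (4 * real p) - 1 / 2"
          using p3 by (simp add: power2_eq_square field_simps)
        moreover have "0 \<le> 1 / (4 * real p)" "1 / (4 * real p) \<le> 1" using p3 by auto
        ultimately show ?thesis by linarith
      qed
      ultimately have "\<bar>real (f_count \<phi> p) - real p / 4\<bar> \<le> sqrt (real p) * ln (real p) + K * (sqrt (real p) * ln (real p))"
        using sl by linarith
      also have "\<dots> = (1 + K) * (sqrt (real p) * ln (real p))" by (simp only: distrib_right mult_1)
      also have "\<dots> \<le> (1 + K + l) * (sqrt (real p) * ln (real p))"
        using sl K0 by (intro mult_right_mono) auto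
      finally show ?thesis .
    next
      case False
      then have "coeff (reduce_mod p \<phi>) m = 0" using assms by (intro coeff_eq_0) auto
      then have "int p dvd lead_coeff \<phi>" using assms by (simp add: coeff_reduce_mod dvd_eq_mod_eq_0)
      moreover have "lead_coeff \<phi> \<noteq> 0" using assms by auto
      ultimately have "\<bar>int p\<bar> \<le> \<bar>lead_coeff \<phi>\<bar>" by (rule dvd_imp_le_int[rotated])
      then have "real_of_int (int p) \<le> real_of_int \<bar>lead_coeff \<phi>\<bar>" by (simp only: of_int_le_iff abs_of_nat)
      then have pl: "real p \<le> l" by (simp only: l_def of_int_of_nat_eq)
      obtain P where P: "p = 2 * P + 1" using p(2) by (auto elim: oddE)
      have "card {k\<in>{1..int P}. poly \<phi> k mod int p > int P} \<le> card {1..int P}" by (intro card_mono) auto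
      then have "f_count \<phi> p \<le> p" unfolding f_count_altdef[OF P] using P by simp
      then have "real (f_count \<phi> p) \<le> real p" by (simp only: of_nat_le_iff)
      then have "\<bar>real (f_count \<phi> p) - real p / 4\<bar> \<le> l * 1" using pl by linarith
      also have "\<dots> \<le> (1 + K + l) * (sqrt (real p) * ln (real p))"
        using sl K0 by (intro mult_mono) auto
      finally show ?thesis .
    qed
  qed
  moreover have "1 + K + l > 0" by (simp add: K_def l_def add_pos_nonneg)
  ultimately show ?thesis using bound by blast
qed

end
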